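(* Let $p \in \mathbb{N}$ and $\nu = p + \tfrac12$. Let $I \subseteq \mathbb{R}$ be an open interval and let $X \sim \mathcal{GP}(\mu,K_\nu)$, with $\mu \in C^p(I)$ and $K_\nu$ the Matérn covariance function with smoothness parameter $\nu$. Then there exists a modification $\tilde X$ of $X$ such that $\mathbb{P}(\tilde X \in C^p(I)) = 1$.
   Context: For $\nu = p + \tfrac12$ with $p \in \mathbb{N}$, and parameters $\sigma, \rho > 0$, the Matérn covariance function is, for $z,z' \in \mathbb{R}$, $$K_\nu(z,z') = K_\nu(z-z') = \sigma^2 \exp\left(-\frac{|z-z'|}{\rho}\right) \frac{p!}{(2p)!} \sum_{k=0}^p \frac{(2p-k)!}{(p-k)!\,k!} \left(\frac{2}{\rho}\right)^k |z-z'|^k .$$ $C^p(I)$ is the set of $p$ times continuously differentiable functions $I \to \mathbb{R}$. $X \sim \mathcal{GP}(\mu,K_\nu)$ means that $X \colon I \times \Omega \to \mathbb{R}$ is a Gaussian process on a probability space $(\Omega,\mathcal{F},\mathbb{P})$ with mean function $\mu$ and covariance function $K_\nu$. A process $\tilde X$ is a modification of $X$ if $\mathbb{P}(X(z,\omega) = \tilde X(z,\omega)) = 1$ for every $z \in I$. The notation $\tilde X \in C^p(I)$ refers to the sample path $z \mapsto \tilde X(z,\omega)$. *)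

theory Defs
  imports "HOL-Probability.Probability"
begin

(* Gaussian laws include the degenerate ones (point masses), as usual for Gaussian processes. *)
definition gaussian_rv :: "'a measure \<Rightarrow> ('a \<Rightarrow> real) \<Rightarrow> bool" where
  "gaussian_rv M S \<longleftrightarrow> S \<in> borel_measurable M \<and>
     (\<exists>m. distr M borel S = return borel m \<or>
          (\<exists>s>0. distributed M lborel S (normal_density m s)))"

(* A random vector indexed by the finite set J is (jointly) Gaussian if every linear
   combination of its components is Gaussian. *)
definition gaussian_vector :: "'a measure \<Rightarrow> 'i set \<Rightarrow> ('i \<Rightarrow> 'a \<Rightarrow> real) \<Rightarrow> bool" where
  "gaussian_vector M J Y \<longleftrightarrow>
     (\<forall>j\<in>J. Y j \<in> borel_measurable M) \<and>
     (\<forall>a. gaussian_rv M (\<lambda>\<omega>. \<Sum>j\<in>J. a j * Y j \<omega>))"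

definition gaussian_process ::
  "'a measure \<Rightarrow> 'i set \<Rightarrow> ('i \<Rightarrow> real) \<Rightarrow> ('i \<Rightarrow> 'i \<Rightarrow> real) \<Rightarrow> ('i \<Rightarrow> 'a \<Rightarrow> real) \<Rightarrow> bool" where
  "gaussian_process M I \<mu> K X \<longleftrightarrow>
     (\<forall>J. finite J \<and> J \<subseteq> I \<longrightarrow> gaussian_vector M J X) \<and>
     (\<forall>z\<in>I. (\<integral>\<omega>. X z \<omega> \<partial>M) = \<mu> z) \<and>
     (\<forall>z\<in>I. \<forall>z'\<in>I. (\<integral>\<omega>. (X z \<omega> - \<mu> z) * (X z' \<omega> - \<mu> z') \<partial>M) = K z z')"

(* The Matern covariance function with smoothness parameter p + 1/2, scale \<sigma> and length
   scale \<rho>. *)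
definition matern_cov :: "nat \<Rightarrow> real \<Rightarrow> real \<Rightarrow> real \<Rightarrow> real \<Rightarrow> real" where
  "matern_cov p \<sigma> \<rho> z z' =
     \<sigma>\<^sup>2 * exp (- (\<bar>z - z'\<bar> / \<rho>)) * (fact p / fact (2 * p)) *
     (\<Sum>k=0..p. fact (2 * p - k) / (fact (p - k) * fact k) * (2 / \<rho>) ^ k * \<bar>z - z'\<bar> ^ k)"

(* Meant for open I only: there the iterated derivatives at points of I depend only on the
   restriction of f to I. *)
definition Ck_on :: "nat \<Rightarrow> real set \<Rightarrow> (real \<Rightarrow> real) \<Rightarrow> bool" where
  "Ck_on k I f \<longleftrightarrow>
     (\<forall>j<k. \<forall>x\<in>I. (deriv ^^ j) f field_differentiable (at x)) \<and>
     continuous_on I ((deriv ^^ k) f)"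

(* The measure of a non-measurable set is 0, so the equation below also asserts that the set
   is an event. *)
definition is_modification ::
  "'a measure \<Rightarrow> 'i set \<Rightarrow> ('i \<Rightarrow> 'a \<Rightarrow> real) \<Rightarrow> ('i \<Rightarrow> 'a \<Rightarrow> real) \<Rightarrow> bool" where
  "is_modification M I X Y \<longleftrightarrow>
     (\<forall>z\<in>I. Y z \<in> borel_measurable M \<and> measure M {\<omega> \<in> space M. X z \<omega> = Y z \<omega>} = 1)"

end

theory Submission
  imports Defs
begin

text \<open>
  The centred process lies in a linear space of random variables whose fourth moment is at most
  three times the square of the second moment; unlike Gaussianity itself, this inequality passes to
  dominated limits without any work, and it is the only consequence of Gaussianity that is needed.
  The Matern covariance is \<open>2p\<close> times differentiable with a \<open>2p\<close>-th derivative that is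
  Lipschitz at \<open>0\<close>. For \<open>p = 0\<close> the fourth moments of the dyadic increments are summable, which
  gives a continuous modification. For \<open>p > 0\<close> dyadic difference quotients converge
  almost surely to a process with covariance \<open>- k''\<close>, which has a \<open>C\<^sup>p\<^sup>-\<^sup>1\<close> modification by
  induction; integrating the latter recovers the original process, since the Riemann sums converge
  both pathwise and in mean square.
\<close>

subsection \<open>The Matern covariance function\<close>

text \<open>Second moments alone are too weak for continuity: a covariance that is Lipschitz at
  \<open>0\<close> gives increments of variance of order \<open>|s - t|\<close>, and adding these up
  over the roughly \<open>2^n\<close> increments of a dyadic level leaves no decay. The kurtosis
  inequality squares the bound to \<open>|s - t|^2\<close> for fourth moments, which leaves
  \<open>2^(-n)\<close> per level.

  The mean square derivative is fixed only up to a null set at each \<open>t\<close> separately, so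
  it says nothing about the paths of the given process. Hence regularity is built from the highest
  derivative downwards, and the original process is recovered at each fixed point by integration.
  For the induction the derivative must satisfy the same hypotheses as the process it comes from;
  this is why a linear space with a moment inequality is carried along instead of Gaussianity.

  The obstacle on the analytic side is the kink of \<open>exp (- |r| / \<rho>)\<close> at
  \<open>0\<close>, which the polynomial factor of the Matern function cancels up to order
  \<open>2 * p\<close>. The cancellation is not expanded; it comes from a derivative formula that
  lowers the index by one.\<close>

definition lipschitz_at_zero :: "(real \<Rightarrow> real) \<Rightarrow> bool" where
  "lipschitz_at_zero k \<longleftrightarrow> (\<exists>C. \<exists>\<delta>>0. \<forall>h. \<bar>h\<bar> < \<delta> \<longrightarrow> \<bar>k h - k 0\<bar> \<le> C * \<bar>h\<bar>)"

text \<open>The minus sign: a stationary process with covariance \<open>k\<close> has a mean square derivative with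
  covariance \<open>- k''\<close>.\<close>

primrec smooth_cov :: "nat \<Rightarrow> (real \<Rightarrow> real) \<Rightarrow> bool" where
  "smooth_cov 0 k \<longleftrightarrow> lipschitz_at_zero k"
| "smooth_cov (Suc p) k \<longleftrightarrow> (\<exists>k\<^sub>1 k\<^sub>2. (\<forall>x. (k has_real_derivative k\<^sub>1 x) (at x)) \<and>
     (\<forall>x. (k\<^sub>1 has_real_derivative k\<^sub>2 x) (at x)) \<and> smooth_cov p (\<lambda>x. - k\<^sub>2 x))"

lemma DERIV_lipschitz_at_zero:
  assumes "(k has_real_derivative d) (at 0)"
  shows "lipschitz_at_zero k"
proof -
  have "(\<lambda>h. (k h - k 0) / h) \<midarrow>0\<rightarrow> d" using assms by (simp add: DERIV_def)
  then obtain \<delta> where \<delta>: "\<delta> > 0" "\<And>h. h \<noteq> 0 \<Longrightarrow> \<bar>h\<bar> < \<delta> \<Longrightarrow> \<bar>(k h - k 0) / h - d\<bar> < 1"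
    unfolding LIM_eq by (metis real_norm_def diff_zero zero_less_one)
  have "\<bar>k h - k 0\<bar> \<le> (\<bar>d\<bar> + 1) * \<bar>h\<bar>" if "\<bar>h\<bar> < \<delta>" for h
  proof (cases "h = 0")
    case False
    have "\<bar>(k h - k 0) / h\<bar> \<le> \<bar>d\<bar> + 1" using \<delta>(2)[OF False that] by linarith
    then show ?thesis using False by (simp add: abs_divide pos_divide_le_eq)
  qed simp
  then show ?thesis using \<delta>(1) unfolding lipschitz_at_zero_def by blast
qed

lemma smooth_cov_lipschitz_at_zero: "smooth_cov p k \<Longrightarrow> lipschitz_at_zero k"
  by (cases p) (auto intro: DERIV_lipschitz_at_zero)

text \<open>Needed because the second derivative of a Matern function is a combination of two Matern
  functions, and because \<open>matern_cov\<close> is a scalar multiple of one.\<close>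

lemma smooth_cov_lincomb:
  "smooth_cov p f \<Longrightarrow> smooth_cov p g \<Longrightarrow> smooth_cov p (\<lambda>x. a * f x + b * g x)"
proof (induction p arbitrary: f g)
  case 0
  then obtain C \<delta> C' \<delta>' where
    f: "\<delta> > 0" "\<And>h. \<bar>h\<bar> < \<delta> \<Longrightarrow> \<bar>f h - f 0\<bar> \<le> C * \<bar>h\<bar>" and
    g: "\<delta>' > 0" "\<And>h. \<bar>h\<bar> < \<delta>' \<Longrightarrow> \<bar>g h - g 0\<bar> \<le> C' * \<bar>h\<bar>"
    by (auto simp: lipschitz_at_zero_def)
  have "\<bar>(a * f h + b * g h) - (a * f 0 + b * g 0)\<bar> \<le> (\<bar>a\<bar> * C + \<bar>b\<bar> * C') * \<bar>h\<bar>"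
    if "\<bar>h\<bar> < min \<delta> \<delta>'" for h
  proof -
    have "\<bar>(a * f h + b * g h) - (a * f 0 + b * g 0)\<bar> = \<bar>a * (f h - f 0) + b * (g h - g 0)\<bar>"
      by (simp add: algebra_simps)
    also have "\<dots> \<le> \<bar>a\<bar> * \<bar>f h - f 0\<bar> + \<bar>b\<bar> * \<bar>g h - g 0\<bar>"
      by (metis abs_triangle_ineq abs_mult)
    also have "\<dots> \<le> \<bar>a\<bar> * (C * \<bar>h\<bar>) + \<bar>b\<bar> * (C' * \<bar>h\<bar>)"
      using that by (intro add_mono mult_left_mono f g) auto
    finally show ?thesis by (simp add: algebra_simps)
  qed
  then show ?case
    unfolding smooth_cov.simps lipschitz_at_zero_def using f(1) g(1) by (metis min_less_iff_conj)
next
  case (Suc p)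
  from Suc.prems obtain f\<^sub>1 f\<^sub>2 g\<^sub>1 g\<^sub>2 where
    f: "\<And>x. (f has_real_derivative f\<^sub>1 x) (at x)" "\<And>x. (f\<^sub>1 has_real_derivative f\<^sub>2 x) (at x)"
      "smooth_cov p (\<lambda>x. - f\<^sub>2 x)" and
    g: "\<And>x. (g has_real_derivative g\<^sub>1 x) (at x)" "\<And>x. (g\<^sub>1 has_real_derivative g\<^sub>2 x) (at x)"
      "smooth_cov p (\<lambda>x. - g\<^sub>2 x)"
    by auto
  have "smooth_cov p (\<lambda>x. - (a * f\<^sub>2 x + b * g\<^sub>2 x))"
    using Suc.IH[OF f(3) g(3)] by simp
  then show ?case
    unfolding smooth_cov.simps
    by (intro exI[of _ "\<lambda>x. a * f\<^sub>1 x + b * g\<^sub>1 x"] exI[of _ "\<lambda>x. a * f\<^sub>2 x + b * g\<^sub>2 x"])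
      (auto intro!: derivative_eq_intros f g)
qed

section \<open>Expansion of a covariance at the origin\<close>

text \<open>The Lipschitz bound on \<open>k\<^sub>2\<close> is integrated once, and then once more,
  by the mean value inequality. The symmetric combination \<open>k h + k (- h)\<close> removes the
  first-order term. The first estimate controls covariances between the process and its derivative,
  the second the variances of its second differences.\<close>

lemma second_order_expansion:
  fixes k k\<^sub>1 k\<^sub>2 :: "real \<Rightarrow> real"
  assumes k: "\<And>x. (k has_real_derivative k\<^sub>1 x) (at x)"
    and k1: "\<And>x. (k\<^sub>1 has_real_derivative k\<^sub>2 x) (at x)"
    and lip: "lipschitz_at_zero k\<^sub>2"
  obtains C \<delta> where "0 \<le> C" "0 < \<delta>"
    "\<And>h. \<bar>h\<bar> < \<delta> \<Longrightarrow> \<bar>k\<^sub>1 h - k\<^sub>1 0 - h * k\<^sub>2 0\<bar> \<le> C * h\<^sup>2"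
    "\<And>h. \<bar>h\<bar> < \<delta> \<Longrightarrow> \<bar>k h + k (- h) - 2 * k 0 - h\<^sup>2 * k\<^sub>2 0\<bar> \<le> C * \<bar>h\<bar> ^ 3"
proof -
  obtain C' \<delta> where \<delta>: "\<delta> > 0" and C': "\<And>h. \<bar>h\<bar> < \<delta> \<Longrightarrow> \<bar>k\<^sub>2 h - k\<^sub>2 0\<bar> \<le> C' * \<bar>h\<bar>"
    using lip by (auto simp: lipschitz_at_zero_def)
  define C where "C = \<bar>C'\<bar>"
  have C0: "0 \<le> C" by (simp add: C_def)
  have C: "\<bar>k\<^sub>2 h - k\<^sub>2 0\<bar> \<le> C * \<bar>h\<bar>" if "\<bar>h\<bar> < \<delta>" for h
    by (rule order_trans[OF C'[OF that]]) (auto simp: C_def intro!: mult_right_mono)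
  have first: "\<bar>k\<^sub>1 h - k\<^sub>1 0 - h * k\<^sub>2 0\<bar> \<le> C * h\<^sup>2" if h: "\<bar>h\<bar> < \<delta>" for h
  proof -
    have "norm ((k\<^sub>1 h - h * k\<^sub>2 0) - (k\<^sub>1 0 - 0 * k\<^sub>2 0)) \<le> (C * \<bar>h\<bar>) * norm (h - 0)"
    proof (rule field_differentiable_bound[of "cball 0 \<bar>h\<bar>" _ "\<lambda>x. k\<^sub>2 x - k\<^sub>2 0"])
      fix x :: real assume "x \<in> cball 0 \<bar>h\<bar>"
      then have x: "\<bar>x\<bar> \<le> \<bar>h\<bar>" by simp
      show "((\<lambda>x. k\<^sub>1 x - x * k\<^sub>2 0) has_real_derivative k\<^sub>2 x - k\<^sub>2 0) (at x within cball 0 \<bar>h\<bar>)"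
        by (rule has_field_derivative_at_within) (auto intro!: derivative_eq_intros k1)
      show "norm (k\<^sub>2 x - k\<^sub>2 0) \<le> C * \<bar>h\<bar>"
        using C[of x] x h mult_left_mono[OF x C0] by auto
    qed auto
    then show ?thesis by (simp add: power2_eq_square algebra_simps)
  qed
  have "\<bar>k h + k (- h) - 2 * k 0 - h\<^sup>2 * k\<^sub>2 0\<bar> \<le> 2 * C * \<bar>h\<bar> ^ 3" if h: "\<bar>h\<bar> < \<delta>" for h
  proof -
    have "norm ((k h + k (- h) - h\<^sup>2 * k\<^sub>2 0) - (k 0 + k (- 0) - 0\<^sup>2 * k\<^sub>2 0)) \<le> (2 * C * h\<^sup>2) * norm (h - 0)"
    proof (rule field_differentiable_bound[of "cball 0 \<bar>h\<bar>" _ "\<lambda>x. k\<^sub>1 x - k\<^sub>1 (- x) - 2 * x * k\<^sub>2 0"])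
      fix x :: real assume "x \<in> cball 0 \<bar>h\<bar>"
      then have x: "\<bar>x\<bar> \<le> \<bar>h\<bar>" by simp
      show "((\<lambda>x. k x + k (- x) - x\<^sup>2 * k\<^sub>2 0) has_real_derivative k\<^sub>1 x - k\<^sub>1 (- x) - 2 * x * k\<^sub>2 0)
          (at x within cball 0 \<bar>h\<bar>)"
        by (rule has_field_derivative_at_within)
          (auto intro!: derivative_eq_intros k DERIV_chain2[OF k])
      have "x\<^sup>2 \<le> h\<^sup>2" using x by (simp add: abs_le_square_iff)
      then have "C * x\<^sup>2 \<le> C * h\<^sup>2" using C0 by (intro mult_left_mono)
      moreover have "\<bar>k\<^sub>1 x - k\<^sub>1 0 - x * k\<^sub>2 0\<bar> \<le> C * x\<^sup>2" "\<bar>k\<^sub>1 (- x) - k\<^sub>1 0 - (- x) * k\<^sub>2 0\<bar> \<le> C * x\<^sup>2"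
        using first[of x] first[of "- x"] x h by auto
      ultimately show "norm (k\<^sub>1 x - k\<^sub>1 (- x) - 2 * x * k\<^sub>2 0) \<le> 2 * C * h\<^sup>2"
        unfolding real_norm_def by linarith
    qed auto
    then show ?thesis by (simp add: power3_eq_cube power2_eq_square mult.assoc)
  qed
  moreover have "\<bar>k\<^sub>1 h - k\<^sub>1 0 - h * k\<^sub>2 0\<bar> \<le> 2 * C * h\<^sup>2" if "\<bar>h\<bar> < \<delta>" for h
    by (rule order_trans[OF first[OF that]]) (use C0 in \<open>auto intro!: mult_right_mono\<close>)
  ultimately show thesis using \<delta> C0 by (intro that[of "2 * C" \<delta>]) auto
qed

section \<open>Derivatives of the Matern functions\<close>

text \<open>Away from \<open>0\<close> this is the chain rule. At \<open>0\<close> the left and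
  right slopes are opposite, so they agree exactly because \<open>f' 0 = 0\<close>; in absolute
  value the difference quotient at \<open>h\<close> is that of \<open>f\<close> at
  \<open>|h|\<close>.\<close>

lemma DERIV_comp_abs:
  fixes f :: "real \<Rightarrow> real"
  assumes f: "\<And>x. (f has_real_derivative f' x) (at x)" and f0: "f' 0 = 0"
  shows "((\<lambda>r. f \<bar>r\<bar>) has_real_derivative sgn r * f' \<bar>r\<bar>) (at r)"
proof -
  consider "r > 0" | "r < 0" | "r = 0" by linarith
  then show ?thesis
  proof cases
    case 1
    have "((\<lambda>r. f \<bar>r\<bar>) has_real_derivative f' r) (at r)"
      by (rule has_field_derivative_transform_within_open[OF f[of r], of "{0<..}"]) (use 1 in auto)
    then show ?thesis using 1 by simp
  next
    case 2
    have "((\<lambda>r. f (- r)) has_real_derivative - f' (- r)) (at r)"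
      using f[of "- r"] by (simp add: DERIV_mirror)
    then have "((\<lambda>r. f \<bar>r\<bar>) has_real_derivative - f' (- r)) (at r)"
      by (rule has_field_derivative_transform_within_open[of _ _ _ "{..<0}"]) (use 2 in auto)
    then show ?thesis using 2 by simp
  next
    case 3
    have "(\<lambda>h. (f h - f 0) / h) \<midarrow>0\<rightarrow> 0" using f[of 0] f0 by (simp add: DERIV_def)
    moreover have "filterlim (\<lambda>h::real. \<bar>h\<bar>) (at 0) (at 0)"
      unfolding filterlim_at by (auto intro!: tendsto_eq_intros simp: eventually_at_filter)
    ultimately have "((\<lambda>h. (f \<bar>h\<bar> - f 0) / \<bar>h\<bar>) \<longlongrightarrow> 0) (at 0)"
      by (rule filterlim_compose)
    then have "((\<lambda>h. \<bar>(f \<bar>h\<bar> - f 0) / h\<bar>) \<longlongrightarrow> 0) (at 0)"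
      using tendsto_rabs_zero by (fastforce simp: abs_divide)
    then have "((\<lambda>h. (f \<bar>h\<bar> - f 0) / h) \<longlongrightarrow> 0) (at 0)" by (simp only: tendsto_rabs_zero_iff)
    then show ?thesis using 3 by (simp add: DERIV_def)
  qed
qed

text \<open>The recurrence of the reverse Bessel polynomials; unlike the closed form it makes the
  derivatives of the Matern function easy to compute.\<close>

fun matern_fun :: "real \<Rightarrow> nat \<Rightarrow> real \<Rightarrow> real" where
  "matern_fun \<rho> 0 r = exp (- (\<bar>r\<bar> / \<rho>))"
| "matern_fun \<rho> (Suc 0) r = exp (- (\<bar>r\<bar> / \<rho>)) * (2 + 2 * (\<bar>r\<bar> / \<rho>))"
| "matern_fun \<rho> (Suc (Suc p)) r =
     (4 * real p + 6) * matern_fun \<rho> (Suc p) r + 4 * (r / \<rho>)\<^sup>2 * matern_fun \<rho> p r"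

text \<open>With \<open>x = |r| / \<rho>\<close> and \<open>\<nu> = p + 1/2\<close>,
  \<open>matern_fun \<rho> p\<close> is a constant multiple of \<open>x^\<nu>\<close> times the
  modified Bessel function of the second kind of order \<open>\<nu>\<close>, and this is the
  classical formula for the derivative of that product. The induction differentiates the recurrence;
  the factor \<open>r\<close> in the result cancels the kink at \<open>0\<close>.\<close>

lemma DERIV_matern_fun:
  assumes "\<rho> > 0"
  shows "(matern_fun \<rho> (Suc p) has_real_derivative - 2 * r / \<rho>\<^sup>2 * matern_fun \<rho> p r) (at r)"
proof -
  have 0: "(matern_fun \<rho> (Suc 0) has_real_derivative - 2 * r / \<rho>\<^sup>2 * matern_fun \<rho> 0 r) (at r)" for r
  proof -
    have "((\<lambda>x. exp (- (x / \<rho>)) * (2 + 2 * (x / \<rho>))) has_real_derivative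
        - 2 * x / \<rho>\<^sup>2 * exp (- (x / \<rho>))) (at x)" for x
      using assms by (auto intro!: derivative_eq_intros simp: field_simps power2_eq_square)
    from DERIV_comp_abs[OF this, of r]
    have "((\<lambda>r. exp (- (\<bar>r\<bar> / \<rho>)) * (2 + 2 * (\<bar>r\<bar> / \<rho>))) has_real_derivative
        - 2 * (sgn r * \<bar>r\<bar>) / \<rho>\<^sup>2 * matern_fun \<rho> 0 r) (at r)"
      by (simp add: mult_ac)
    also have "(\<lambda>r. exp (- (\<bar>r\<bar> / \<rho>)) * (2 + 2 * (\<bar>r\<bar> / \<rho>))) = matern_fun \<rho> (Suc 0)"
      by (simp add: fun_eq_iff)
    finally show ?thesis by (simp only: sgn_mult_abs)
  qed
  \<comment> \<open>A second base case is unavoidable: the recurrence for index \<open>2\<close>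
    contains \<open>matern_fun \<rho> 0\<close>, which is not differentiable at \<open>0\<close>.
    The polynomial \<open>12 + 12 x + 4 x^2\<close> is that recurrence written out.\<close>
  have 1: "(matern_fun \<rho> (Suc 1) has_real_derivative - 2 * r / \<rho>\<^sup>2 * matern_fun \<rho> 1 r) (at r)" for r
  proof -
    have "((\<lambda>x. exp (- (x / \<rho>)) * (12 + 12 * (x / \<rho>) + 4 * (x / \<rho>)\<^sup>2)) has_real_derivative
        - 2 * x / \<rho>\<^sup>2 * (exp (- (x / \<rho>)) * (2 + 2 * (x / \<rho>)))) (at x)" for x
      using assms by (auto intro!: derivative_eq_intros simp: field_simps power2_eq_square)
    from DERIV_comp_abs[OF this, of r]
    have "((\<lambda>r. exp (- (\<bar>r\<bar> / \<rho>)) * (12 + 12 * (\<bar>r\<bar> / \<rho>) + 4 * (\<bar>r\<bar> / \<rho>)\<^sup>2)) has_real_derivative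
        - 2 * (sgn r * \<bar>r\<bar>) / \<rho>\<^sup>2 * matern_fun \<rho> 1 r) (at r)"
      by (simp add: mult_ac)
    also have "(\<lambda>r. exp (- (\<bar>r\<bar> / \<rho>)) * (12 + 12 * (\<bar>r\<bar> / \<rho>) + 4 * (\<bar>r\<bar> / \<rho>)\<^sup>2)) = matern_fun \<rho> (Suc 1)"
      by (auto simp: fun_eq_iff algebra_simps power_divide)
    finally show ?thesis by (simp only: sgn_mult_abs)
  qed
  show ?thesis
  proof (induction p arbitrary: r rule: induct_nat_012)
    case (ge2 p)
    have sq: "((\<lambda>r. 4 * (r / \<rho>)\<^sup>2) has_real_derivative 8 * r / \<rho>\<^sup>2) (at r)"
      using assms by (auto intro!: derivative_eq_intros simp: field_simps power2_eq_square)
    have "((\<lambda>r. (4 * real (Suc p) + 6) * matern_fun \<rho> (Suc (Suc p)) r + 4 * (r / \<rho>)\<^sup>2 * matern_fun \<rho> (Suc p) r)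
      has_real_derivative - 2 * r / \<rho>\<^sup>2 * matern_fun \<rho> (Suc (Suc p)) r) (at r)"
      by (rule DERIV_cong[OF DERIV_add[OF DERIV_cmult[OF ge2.IH(2)] DERIV_mult[OF sq ge2.IH(1)]]])
        (use assms in \<open>simp add: field_simps power2_eq_square\<close>)
    moreover have "(\<lambda>r. (4 * real (Suc p) + 6) * matern_fun \<rho> (Suc (Suc p)) r
        + 4 * (r / \<rho>)\<^sup>2 * matern_fun \<rho> (Suc p) r) = matern_fun \<rho> (Suc (Suc (Suc p)))"
      by (simp add: fun_eq_iff)
    ultimately show ?case by simp
  qed (use 0 1 in simp_all)
qed

text \<open>For \<open>p > 0\<close> the product rule produces a term with \<open>r^2\<close> and
  index \<open>p - 1\<close>, which the recurrence trades for the indices \<open>p\<close> and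
  \<open>p + 1\<close>. Thus the family of Matern functions is closed under taking second
  derivatives, at the price of one index.\<close>

lemma DERIV_times_matern_fun:
  assumes "\<rho> > 0"
  shows "((\<lambda>r. - 2 * r / \<rho>\<^sup>2 * matern_fun \<rho> p r) has_real_derivative
    (matern_fun \<rho> (Suc p) r - 4 * (real p + 1) * matern_fun \<rho> p r) / \<rho>\<^sup>2) (at r)"
proof (cases p)
  case 0
  have *: "((\<lambda>r. - 2 * r / \<rho>\<^sup>2 * exp (- (\<bar>r\<bar> / \<rho>))) has_real_derivative
     exp (- (\<bar>r\<bar> / \<rho>)) * (2 * (\<bar>r\<bar> / \<rho>) - 2) / \<rho>\<^sup>2) (at r)"
  proof -
    consider "r > 0" | "r < 0" | "r = 0" by linarith
    then show ?thesis
    proof cases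
      case 1
      have "((\<lambda>r. - 2 * r / \<rho>\<^sup>2 * exp (- (r / \<rho>))) has_real_derivative
         exp (- (r / \<rho>)) * (2 * (r / \<rho>) - 2) / \<rho>\<^sup>2) (at r)"
        using assms by (auto intro!: derivative_eq_intros simp: field_simps power2_eq_square)
      then have "((\<lambda>r. - 2 * r / \<rho>\<^sup>2 * exp (- (\<bar>r\<bar> / \<rho>))) has_real_derivative
         exp (- (r / \<rho>)) * (2 * (r / \<rho>) - 2) / \<rho>\<^sup>2) (at r)"
        by (rule has_field_derivative_transform_within_open[of _ _ _ "{0<..}"]) (use 1 in auto)
      then show ?thesis using 1 by simp
    next
      case 2
      have "((\<lambda>r. - 2 * r / \<rho>\<^sup>2 * exp (- (- r / \<rho>))) has_real_derivative
         exp (- (- r / \<rho>)) * (2 * (- r / \<rho>) - 2) / \<rho>\<^sup>2) (at r)"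
        using assms by (auto intro!: derivative_eq_intros simp: field_simps power2_eq_square)
      then have "((\<lambda>r. - 2 * r / \<rho>\<^sup>2 * exp (- (\<bar>r\<bar> / \<rho>))) has_real_derivative
         exp (- (- r / \<rho>)) * (2 * (- r / \<rho>) - 2) / \<rho>\<^sup>2) (at r)"
        by (rule has_field_derivative_transform_within_open[of _ _ _ "{..<0}"]) (use 2 in auto)
      then show ?thesis using 2 by simp
    next
      case 3
      \<comment> \<open>Caratheodory's criterion: the function is \<open>r\<close> times a
        continuous factor, so its derivative at \<open>0\<close> is the value of that factor,
        although the factor itself has a kink.\<close>
      have "isCont (\<lambda>r. - 2 / \<rho>\<^sup>2 * exp (- (\<bar>r\<bar> / \<rho>))) 0" using assms by (intro continuous_intros) auto
      then show ?thesis
        unfolding 3 CARAT_DERIV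
        by (intro exI[of _ "\<lambda>r. - 2 / \<rho>\<^sup>2 * exp (- (\<bar>r\<bar> / \<rho>))"]) (auto simp: algebra_simps)
    qed
  qed
  then show ?thesis unfolding 0 by (simp add: algebra_simps)
next
  case (Suc q)
  have "((\<lambda>r. - 2 * r / \<rho>\<^sup>2) has_real_derivative - 2 / \<rho>\<^sup>2) (at r)"
    by (rule DERIV_cdivide[OF DERIV_cmult_Id])
  from DERIV_mult[OF this DERIV_matern_fun[OF assms, of q]] show ?thesis
    unfolding Suc by (rule DERIV_cong) (use assms in \<open>simp add: field_simps power2_eq_square\<close>)
qed

text \<open>The range \<open>p \<le> q\<close> in place of \<open>p = q\<close> is what the
  induction needs: the second derivative at index \<open>q' + 1\<close> mixes the indices
  \<open>q'\<close> and \<open>q' + 1\<close>, one of which is smoother than required.\<close>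

lemma smooth_cov_matern_fun:
  assumes "\<rho> > 0" "p \<le> q"
  shows "smooth_cov p (matern_fun \<rho> q)"
  using assms(2)
proof (induction p arbitrary: q)
  case 0
  show ?case
  proof (cases q)
    case 0
    have "\<bar>exp (- x) - 1\<bar> \<le> x" if "0 \<le> x" for x :: real
      using that exp_ge_add_one_self[of "- x"] by simp
    then have "\<bar>exp (- (\<bar>h\<bar> / \<rho>)) - 1\<bar> \<le> (1 / \<rho>) * \<bar>h\<bar>" for h
      using assms(1) by force
    then show ?thesis unfolding smooth_cov.simps lipschitz_at_zero_def 0
      by - (rule exI[of _ "1 / \<rho>"], rule exI[of _ 1], simp)
  qed (auto intro: DERIV_lipschitz_at_zero[OF DERIV_matern_fun[OF assms(1)]])
next
  case (Suc p)
  then obtain q' where q: "q = Suc q'" "p \<le> q'" by (cases q) auto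
  have "smooth_cov p (\<lambda>x. (- 1 / \<rho>\<^sup>2) * matern_fun \<rho> (Suc q') x + (4 * (real q' + 1) / \<rho>\<^sup>2) * matern_fun \<rho> q' x)"
    using q by (intro smooth_cov_lincomb Suc.IH) auto
  also have "(\<lambda>x. (- 1 / \<rho>\<^sup>2) * matern_fun \<rho> (Suc q') x + (4 * (real q' + 1) / \<rho>\<^sup>2) * matern_fun \<rho> q' x)
     = (\<lambda>x. - ((matern_fun \<rho> (Suc q') x - 4 * (real q' + 1) * matern_fun \<rho> q' x) / \<rho>\<^sup>2))"
    by (simp add: fun_eq_iff diff_divide_distrib)
  finally show ?case
    unfolding smooth_cov.simps q(1)
    using DERIV_matern_fun[OF assms(1), of q'] DERIV_times_matern_fun[OF assms(1), of q']
    by (intro exI conjI allI)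
qed

section \<open>Closed form of the Matern functions\<close>

text \<open>The value \<open>0\<close> beyond \<open>p\<close> lets the coefficient recurrence hold
  at every index, including the top ones.\<close>

definition matern_coeff :: "nat \<Rightarrow> nat \<Rightarrow> real" where
  "matern_coeff p k = (if k \<le> p then fact (2 * p - k) / (fact (p - k) * fact k) else 0)"

text \<open>In the variable \<open>y = 2 |r| / \<rho>\<close> the recurrence reads
  \<open>(4 p + 6) f + y^2 g\<close>. The factor \<open>y^2\<close> shifts coefficients by two, so
  the powers \<open>0\<close> and \<open>1\<close> receive only the first term.\<close>

lemma matern_coeff_0: "matern_coeff (Suc (Suc p)) 0 = (4 * real p + 6) * matern_coeff (Suc p) 0"
proof -
  \<comment> \<open>The factorials are replaced by arbitrary reals \<open>F\<close> and
    \<open>G\<close>, which leaves an identity of rational functions.\<close>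
  have *: "((2 * x + 4) * ((2 * x + 3) * F)) / ((x + 2) * G) = (4 * x + 6) * (F / G)"
    if "x \<ge> 0" "G > 0" for x F G :: real
    using that by (simp add: divide_simps) algebra
  have "2 * Suc (Suc p) = Suc (Suc (2 * Suc p))" by simp
  then have "fact (2 * Suc (Suc p)) = (2 * real p + 4) * ((2 * real p + 3) * fact (2 * Suc p))"
    by (simp only: fact_Suc) (simp add: algebra_simps del: mult_Suc_right)
  moreover have "fact (Suc (Suc p)) = (real p + 2) * fact (Suc p)"
    by (subst fact_Suc) (simp add: algebra_simps del: fact_Suc)
  ultimately show ?thesis
    using *[of p "fact (Suc p)" "fact (2 * Suc p)"] by (simp add: matern_coeff_def del: fact_Suc mult_Suc_right)
qed

lemma matern_coeff_1:
  "matern_coeff (Suc (Suc p)) (Suc 0) = (4 * real p + 6) * matern_coeff (Suc p) (Suc 0)"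
proof -
  have *: "((2 * x + 3) * ((2 * x + 2) * F)) / ((x + 1) * G) = (4 * x + 6) * (F / G)"
    if "x \<ge> 0" "G > 0" for x F G :: real
    using that by (simp add: divide_simps) algebra
  have "2 * Suc (Suc p) - Suc 0 = Suc (Suc (Suc (2 * p)))" "2 * Suc p - Suc 0 = Suc (2 * p)"
    by simp_all
  moreover have "fact (Suc (Suc (Suc (2 * p)))) = (2 * real p + 3) * ((2 * real p + 2) * fact (Suc (2 * p)))"
    by (subst fact_Suc, subst fact_Suc) (simp add: algebra_simps del: fact_Suc)
  moreover have "fact (Suc p) = (real p + 1) * fact p" by (simp add: algebra_simps)
  ultimately show ?thesis
    using *[of p "fact p" "fact (Suc (2 * p))"] by (simp add: matern_coeff_def del: fact_Suc mult_Suc_right)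
qed

lemma matern_coeff_Suc_Suc:
  "matern_coeff (Suc (Suc p)) (Suc (Suc k)) =
     (4 * real p + 6) * matern_coeff (Suc p) (Suc (Suc k)) + matern_coeff p k"
proof -
  consider "k < p" | "k = p" | "p < k" by linarith
  then show ?thesis
  proof cases
    case 1
    \<comment> \<open>Writing \<open>p = k + j + 1\<close> removes all truncated subtraction from
      the factorials.\<close>
    then obtain j where p: "p = Suc (k + j)" using less_imp_Suc_add by blast
    have "2 * Suc (Suc p) - Suc (Suc k) = Suc (Suc (k + 2 * j + 2))"
      "2 * Suc p - Suc (Suc k) = k + 2 * j + 2" "2 * p - k = k + 2 * j + 2"
      "p - k = Suc j" "Suc p - Suc (Suc k) = j" "Suc (Suc p) - Suc (Suc k) = Suc j"
      using p by auto
    moreover have "fact (Suc (Suc (k + 2 * j + 2))) =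
        (real k + 2 * real j + 4) * ((real k + 2 * real j + 3) * fact (k + 2 * j + 2))"
      by (subst fact_Suc, subst fact_Suc) (simp add: algebra_simps del: fact_Suc)
    moreover have "fact (Suc j) = (real j + 1) * fact j" by (simp add: algebra_simps)
    moreover have "fact (Suc (Suc k)) = (real k + 2) * ((real k + 1) * fact k)" by (simp add: algebra_simps)
    moreover have K: "((x + 2 * y + 4) * ((x + 2 * y + 3) * F)) / (((y + 1) * A) * ((x + 2) * ((x + 1) * B))) =
        (4 * (x + y + 1) + 6) * (F / (A * ((x + 2) * ((x + 1) * B)))) + F / (((y + 1) * A) * B)"
      if "x \<ge> 0" "y \<ge> 0" "A > 0" "B > 0" for x y F A B :: real
    proof -
      have "x + 2 \<noteq> 0" "x + 1 \<noteq> 0" "y + 1 \<noteq> 0" using that by auto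
      then show ?thesis using that by (simp add: divide_simps) algebra
    qed
    ultimately show ?thesis
      using K[of k j "fact j" "fact k" "fact (k + 2 * j + 2)"] 1 p unfolding matern_coeff_def by (simp del: fact_Suc mult_Suc_right)
  next
    case 2
    have "2 * p - p = p" by simp
    then show ?thesis using 2 by (simp add: matern_coeff_def)
  qed (simp add: matern_coeff_def)
qed

lemma matern_fun_closed_form:
  "matern_fun \<rho> p r = exp (- (\<bar>r\<bar> / \<rho>)) * (\<Sum>k\<le>p. matern_coeff p k * (2 * (\<bar>r\<bar> / \<rho>)) ^ k)"
proof (induction p rule: induct_nat_012)
  case 0
  show ?case by (simp add: matern_coeff_def)
next
  case 1
  show ?case by (simp add: matern_coeff_def)
next
  case (ge2 p)
  define y where "y = 2 * (\<bar>r\<bar> / \<rho>)"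
  have y2: "4 * (r / \<rho>)\<^sup>2 = y\<^sup>2" by (simp add: y_def power_mult_distrib power_divide)
  have "(\<Sum>k\<le>Suc (Suc p). matern_coeff (Suc (Suc p)) k * y ^ k) =
      matern_coeff (Suc (Suc p)) 0 + matern_coeff (Suc (Suc p)) (Suc 0) * y +
      (\<Sum>k\<le>p. matern_coeff (Suc (Suc p)) (Suc (Suc k)) * y ^ Suc (Suc k))"
    by (simp only: sum.atMost_Suc_shift) simp
  also have "\<dots> = (4 * real p + 6) * (matern_coeff (Suc p) 0 + matern_coeff (Suc p) (Suc 0) * y +
      (\<Sum>k\<le>p. matern_coeff (Suc p) (Suc (Suc k)) * y ^ Suc (Suc k)))
      + y\<^sup>2 * (\<Sum>k\<le>p. matern_coeff p k * y ^ k)"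
    by (simp add: matern_coeff_0 matern_coeff_1 matern_coeff_Suc_Suc sum.distrib sum_distrib_left
        algebra_simps power2_eq_square)
  also have "matern_coeff (Suc p) 0 + matern_coeff (Suc p) (Suc 0) * y +
      (\<Sum>k\<le>p. matern_coeff (Suc p) (Suc (Suc k)) * y ^ Suc (Suc k)) =
      (\<Sum>k\<le>Suc (Suc p). matern_coeff (Suc p) k * y ^ k)"
    by (simp only: sum.atMost_Suc_shift) simp
  \<comment> \<open>The extra top term, added so that both sums run over the same range, has
    coefficient \<open>0\<close>.\<close>
  also have "\<dots> = (\<Sum>k\<le>Suc p. matern_coeff (Suc p) k * y ^ k)"
    by (simp add: matern_coeff_def)
  finally show ?case
    unfolding matern_fun.simps ge2.IH y2 y_def[symmetric] by (simp add: algebra_simps)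
qed

lemma matern_cov_eq_matern_fun:
  "matern_cov p \<sigma> \<rho> z z' = \<sigma>\<^sup>2 * (fact p / fact (2 * p) :: real) * matern_fun \<rho> p (z - z')"
proof -
  have "(\<Sum>k=0..p. fact (2 * p - k) / (fact (p - k) * fact k) * (2 / \<rho>) ^ k * \<bar>z - z'\<bar> ^ k) =
    (\<Sum>k\<le>p. matern_coeff p k * (2 * (\<bar>z - z'\<bar> / \<rho>)) ^ k)"
    by (rule sum.cong) (auto simp: matern_coeff_def power_mult_distrib power_divide)
  then show ?thesis unfolding matern_cov_def matern_fun_closed_form by simp
qed

lemma smooth_cov_matern_cov:
  assumes "\<rho> > 0"
  shows "smooth_cov p (\<lambda>r. matern_cov p \<sigma> \<rho> r 0)"
  using smooth_cov_lincomb[OF smooth_cov_matern_fun[OF assms order_refl] smooth_cov_matern_fun[OF assms order_refl],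
      of p "\<sigma>\<^sup>2 * (fact p / fact (2 * p))" 0]
  unfolding matern_cov_eq_matern_fun by simp

subsection \<open>Riemann sums and functions of class \<open>C\<^sup>k\<close>\<close>

lemma DERIV_seq:
  assumes "(f has_real_derivative d) (at x)" "h \<longlonglongrightarrow> 0" "\<And>n. h n \<noteq> 0"
  shows "(\<lambda>n. (f (x + h n) - f x) / h n) \<longlonglongrightarrow> d"
proof -
  have "filterlim h (at 0) sequentially" using assms by (simp add: filterlim_at)
  then show ?thesis using assms(1) unfolding DERIV_def by (rule filterlim_compose[rotated])
qed

text \<open>On each of the \<open>n\<close> pieces the mean value inequality, applied to
  \<open>\<Phi>\<close> minus the linear function of slope \<open>\<phi> (i / n)\<close>, compares a
  summand with the increment of \<open>\<Phi>\<close>. Uniform continuity makes each error at most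
  \<open>e / 2 * (1 / n)\<close>, and the increments telescope.\<close>

lemma Riemann_sum_tendsto:
  fixes \<phi> \<Phi> :: "real \<Rightarrow> real"
  assumes deriv: "\<And>x. x \<in> {0..1} \<Longrightarrow> (\<Phi> has_real_derivative \<phi> x) (at x within {0..1})"
    and cont: "continuous_on {0..1} \<phi>"
  shows "(\<lambda>n::nat. \<Sum>i<n. \<phi> (real i / real n) / real n) \<longlonglongrightarrow> \<Phi> 1 - \<Phi> 0"
proof (rule LIMSEQ_I)
  fix e :: real assume e: "e > 0"
  have "uniformly_continuous_on {0..1} \<phi>" using cont by (rule compact_uniformly_continuous) simp
  then obtain \<delta> where \<delta>: "\<delta> > 0"
    "\<And>x y. x \<in> {0..1} \<Longrightarrow> y \<in> {0..1} \<Longrightarrow> dist y x < \<delta> \<Longrightarrow> dist (\<phi> y) (\<phi> x) < e / 2"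
    unfolding uniformly_continuous_on_def using half_gt_zero[OF e] by blast
  obtain N :: nat where N: "1 / \<delta> < N" using reals_Archimedean2 by blast
  show "\<exists>no. \<forall>n::nat\<ge>no. norm ((\<Sum>i<n. \<phi> (real i / real n) / real n) - (\<Phi> 1 - \<Phi> 0)) < e"
  proof (intro exI[of _ "max 1 N"] allI impI)
    fix n :: nat assume n: "max 1 N \<le> n"
    then have n0: "0 < n" and "N \<le> n" by auto
    then have "real N \<le> real n" by simp
    then have "1 / \<delta> < n" using N by linarith
    then have nd: "1 / n < \<delta>" using \<delta>(1) n0 by (simp add: field_simps)
    have piece: "\<bar>\<phi> (real i / real n) / real n - (\<Phi> (Suc i / n) - \<Phi> (i / n))\<bar> \<le> e / 2 * (1 / n)" if "i < n" for i
    proof -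
      let ?S = "{real i / n .. real (Suc i) / n}"
      have len: "real (Suc i) / n = i / n + 1 / n" by (simp add: add_divide_distrib)
      have le: "real i / n \<le> real (Suc i) / n" by (intro divide_right_mono) auto
      have "real (Suc i) / n \<le> 1" using that n0 by (simp add: field_simps)
      then have sub: "?S \<subseteq> {0..1}" by auto
      have "norm ((\<Phi> (Suc i / n) - (Suc i / n) * \<phi> (i / n)) - (\<Phi> (i / n) - (i / n) * \<phi> (i / n)))
        \<le> e / 2 * norm (Suc i / n - i / n)"
      proof (rule field_differentiable_bound[of ?S _ "\<lambda>x. \<phi> x - \<phi> (i / n)"])
        fix x assume x: "x \<in> ?S"
        then have "(\<Phi> has_real_derivative \<phi> x) (at x within ?S)"
          using deriv sub by (blast intro: DERIV_subset)
        then show "((\<lambda>x. \<Phi> x - x * \<phi> (i / n)) has_real_derivative \<phi> x - \<phi> (i / n)) (at x within ?S)"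
          by (auto intro!: derivative_eq_intros)
        have "dist x (i / n) < \<delta>" using x nd unfolding len by (auto simp: dist_real_def)
        moreover have "real i / n \<in> ?S" using le by simp
        ultimately have "dist (\<phi> x) (\<phi> (i / n)) < e / 2" using \<delta>(2)[of "i / n" x] x sub by blast
        then show "norm (\<phi> x - \<phi> (i / n)) \<le> e / 2" by (simp add: dist_real_def)
      qed (use le in auto)
      also have "real (Suc i) / n - i / n = 1 / n" by (simp only: len)
      also have "(\<Phi> (Suc i / n) - (Suc i / n) * \<phi> (i / n)) - (\<Phi> (i / n) - (i / n) * \<phi> (i / n)) =
        (\<Phi> (Suc i / n) - \<Phi> (i / n)) - (real (Suc i) / n - i / n) * \<phi> (i / n)"
        by (simp only: left_diff_distrib)
      also have "real (Suc i) / n - i / n = 1 / n" by (simp only: len)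
      finally show ?thesis by (simp add: abs_minus_commute)
    qed
    have "\<Phi> 1 - \<Phi> 0 = (\<Sum>i<n. \<Phi> (Suc i / n) - \<Phi> (i / n))"
      using n0 by (subst sum_lessThan_telescope) simp
    then have "(\<Sum>i<n. \<phi> (real i / real n) / real n) - (\<Phi> 1 - \<Phi> 0) =
      (\<Sum>i<n. \<phi> (real i / real n) / real n - (\<Phi> (Suc i / n) - \<Phi> (i / n)))"
      by (simp add: sum_subtractf)
    then have "norm ((\<Sum>i<n. \<phi> (real i / real n) / real n) - (\<Phi> 1 - \<Phi> 0)) \<le>
      (\<Sum>i<n. \<bar>\<phi> (real i / real n) / real n - (\<Phi> (Suc i / n) - \<Phi> (i / n))\<bar>)"
      by (simp only: real_norm_def) (rule sum_abs)
    also have "\<dots> \<le> (\<Sum>i<n. e / 2 * (1 / n))" by (intro sum_mono piece) simp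
    also have "\<dots> = e / 2" using n0 by simp
    also have "\<dots> < e" using e by simp
    finally show "norm ((\<Sum>i<n. \<phi> (real i / real n) / real n) - (\<Phi> 1 - \<Phi> 0)) < e" .
  qed
qed

text \<open>The fundamental theorem is available on compact intervals with a one-sided derivative at
  the ends. A compact interval inside \<open>I\<close> that contains \<open>a\<close> and has
  \<open>x\<close> in its interior turns this into a full derivative.\<close>

lemma interval_lebesgue_integral_has_derivative:
  fixes f :: "real \<Rightarrow> real"
  assumes I: "open I" "is_interval I" and "a \<in> I" "x \<in> I" and cont: "continuous_on I f"
  shows "((\<lambda>u. LBINT y=a..u. f y) has_real_derivative f x) (at x)"
proof -
  obtain \<epsilon> where \<epsilon>: "\<epsilon> > 0" "cball x \<epsilon> \<subseteq> I" using I(1) \<open>x \<in> I\<close> by (meson open_contains_cball)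
  define c d where "c = min a (x - \<epsilon>)" and "d = max a (x + \<epsilon>)"
  have "x - \<epsilon> \<in> I" "x + \<epsilon> \<in> I" using \<epsilon> by (auto simp: dist_real_def subset_eq)
  then have cdI: "c \<in> I" "d \<in> I" using \<open>a \<in> I\<close> by (auto simp: c_def d_def min_def max_def)
  have sub: "{c..d} \<subseteq> I"
    by (auto intro: mem_is_interval_1_I[OF I(2) cdI])
  have cd: "c \<le> a" "a \<le> d" "c < x" "x < d" using \<epsilon> by (auto simp: c_def d_def)
  have "((\<lambda>u. LBINT y=a..u. f y) has_vector_derivative f x) (at x within {c..d})"
    by (rule interval_integral_FTC2) (use cd sub cont in \<open>auto intro: continuous_on_subset\<close>)
  then show ?thesis
    using cd by (simp add: has_real_derivative_iff_has_vector_derivative at_within_Icc_at)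
qed

lemma is_interval_affine_mem:
  fixes I :: "real set"
  assumes "is_interval I" "a \<in> I" "z \<in> I" "0 \<le> u" "u \<le> 1"
  shows "a + u * (z - a) \<in> I"
proof -
  have "(1 - u) *\<^sub>R a + u *\<^sub>R z \<in> I"
    using is_interval_convex[OF assms(1)] assms(2-) by (intro convexD) auto
  then show ?thesis by (simp add: algebra_simps)
qed

text \<open>Parametrising the segment from \<open>a\<close> to \<open>z\<close> over
  \<open>{0..1}\<close> treats \<open>z < a\<close> and \<open>a \<le> z\<close> alike. The
  convergence serves twice: it identifies the integral with the increment of the process, and it
  shows that the integral of a random path is measurable.\<close>

lemma Riemann_sum_tendsto_interval_integral:
  fixes f :: "real \<Rightarrow> real"
  assumes I: "open I" "is_interval I" and az: "a \<in> I" "z \<in> I" and cont: "continuous_on I f"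
  shows "(\<lambda>n::nat. \<Sum>i<n. (z - a) / real n * f (a + real i / real n * (z - a))) \<longlonglongrightarrow> (LBINT y=a..z. f y)"
proof -
  let ?\<gamma> = "\<lambda>u. a + u * (z - a)"
  have \<gamma>: "?\<gamma> u \<in> I" if "u \<in> {0..1}" for u
    using that by (intro is_interval_affine_mem[OF I(2) az]) auto
  have "(\<lambda>n::nat. \<Sum>i<n. (z - a) * f (?\<gamma> (real i / real n)) / real n) \<longlonglongrightarrow> (LBINT y=a..?\<gamma> 1. f y) - (LBINT y=a..?\<gamma> 0. f y)"
  proof (rule Riemann_sum_tendsto)
    fix u :: real assume "u \<in> {0..1}"
    note FTC = interval_lebesgue_integral_has_derivative[OF I az(1) \<gamma>[OF this] cont]
    have "((\<lambda>u. LBINT y=a..?\<gamma> u. f y) has_real_derivative f (?\<gamma> u) * (z - a)) (at u)"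
      by (rule DERIV_chain2[where f = "\<lambda>u. LBINT y=a..u. f y" and g = ?\<gamma>, OF FTC]) (auto intro!: derivative_eq_intros)
    then show "((\<lambda>u. LBINT y=a..?\<gamma> u. f y) has_real_derivative (z - a) * f (?\<gamma> u)) (at u within {0..1})"
      by (simp add: mult.commute has_field_derivative_at_within)
  next
    show "continuous_on {0..1} (\<lambda>u. (z - a) * f (?\<gamma> u))"
      by (intro continuous_intros continuous_on_compose2[OF cont]) (use \<gamma> in auto)
  qed
  then show ?thesis by (simp add: interval_integral_endpoints_same)
qed

section \<open>Iterated derivatives on open sets\<close>

lemma funpow_deriv_cong:
  assumes "open I" "\<And>x. x \<in> I \<Longrightarrow> f x = g x" "x \<in> I"
  shows "(deriv ^^ j) f x = (deriv ^^ j) g x"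
  using assms(3)
proof (induction j arbitrary: x)
  case (Suc j)
  have "eventually (\<lambda>y. (deriv ^^ j) f y = (deriv ^^ j) g y) (nhds x)"
    using eventually_nhds_in_open[OF assms(1) Suc.prems] by eventually_elim (rule Suc.IH)
  then show ?case by (simp add: deriv_cong_ev)
qed (use assms in simp)

lemma field_differentiable_cong_open:
  assumes "open I" "\<And>x. x \<in> I \<Longrightarrow> f x = g x" "x \<in> I" "f field_differentiable (at x)"
  shows "g field_differentiable (at x)"
proof -
  obtain f' where "(f has_field_derivative f') (at x)"
    using assms(4) by (auto simp: field_differentiable_def)
  then have "(g has_field_derivative f') (at x)"
    by (rule has_field_derivative_transform_within_open[OF _ assms(1,3,2)])
  then show ?thesis by (auto simp: field_differentiable_def)
qed

lemma Ck_on_cong: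
  assumes "open I" "\<And>x. x \<in> I \<Longrightarrow> f x = g x" "Ck_on k I f"
  shows "Ck_on k I g"
proof -
  note eq = funpow_deriv_cong[OF assms(1,2)]
  have "(deriv ^^ j) g field_differentiable (at x)" if "j < k" "x \<in> I" for j x
    using assms(3) that field_differentiable_cong_open[OF assms(1) eq that(2)] by (auto simp: Ck_on_def)
  moreover have "continuous_on I ((deriv ^^ k) g)"
    using assms(3) eq by (auto simp: Ck_on_def cong: continuous_on_cong)
  ultimately show ?thesis by (simp add: Ck_on_def)
qed

lemma Ck_on_Suc:
  assumes "open I" and f: "\<And>x. x \<in> I \<Longrightarrow> (f has_real_derivative g x) (at x)" and "Ck_on k I g"
  shows "Ck_on (Suc k) I f"
proof -
  have "g x = deriv f x" if "x \<in> I" for x using DERIV_imp_deriv[OF f[OF that]] by simp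
  then have k: "Ck_on k I (deriv f)" by (rule Ck_on_cong[OF assms(1) _ assms(3)])
  have "(deriv ^^ j) f field_differentiable (at x)" if "j < Suc k" "x \<in> I" for j x
  proof (cases j)
    case 0
    then show ?thesis using f[OF that(2)] by (auto simp: field_differentiable_def)
  next
    case (Suc i)
    then show ?thesis using k that by (simp add: Ck_on_def funpow_swap1)
  qed
  moreover have "continuous_on I ((deriv ^^ Suc k) f)" using k by (simp add: Ck_on_def funpow_swap1)
  ultimately show ?thesis by (simp add: Ck_on_def)
qed

text \<open>Used to put the mean function back. \<open>deriv\<close> is additive only where both
  functions are differentiable, so additivity of iterated derivatives is proved on all of
  \<open>I\<close> and only up to order \<open>k\<close>, each order holding in a neighbourhood
  before the next is taken.\<close>

lemma Ck_on_add:
  assumes "open I" "Ck_on k I f" "Ck_on k I g"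
  shows "Ck_on k I (\<lambda>x. f x + g x)"
proof -
  have eq: "(deriv ^^ j) (\<lambda>x. f x + g x) x = (deriv ^^ j) f x + (deriv ^^ j) g x"
    if "j \<le> k" "x \<in> I" for j x
    using that
  proof (induction j arbitrary: x)
    case (Suc j)
    have "eventually (\<lambda>y. (deriv ^^ j) (\<lambda>x. f x + g x) y = (deriv ^^ j) f y + (deriv ^^ j) g y) (nhds x)"
      using eventually_nhds_in_open[OF assms(1) Suc.prems(2)]
      by eventually_elim (use Suc in auto)
    then have "(deriv ^^ Suc j) (\<lambda>x. f x + g x) x = deriv (\<lambda>y. (deriv ^^ j) f y + (deriv ^^ j) g y) x"
      by (simp add: deriv_cong_ev)
    also have "\<dots> = (deriv ^^ Suc j) f x + (deriv ^^ Suc j) g x"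
      using assms(2,3) Suc.prems by (auto simp: Ck_on_def intro!: deriv_add)
    finally show ?case .
  qed simp
  have "(deriv ^^ j) (\<lambda>x. f x + g x) field_differentiable (at x)" if "j < k" "x \<in> I" for j x
  proof (rule field_differentiable_cong_open[OF assms(1) _ that(2)])
    show "(\<lambda>x. (deriv ^^ j) f x + (deriv ^^ j) g x) field_differentiable (at x)"
      using assms(2,3) that by (auto simp: Ck_on_def intro!: field_differentiable_add)
  qed (use that eq in auto)
  moreover have "continuous_on I ((deriv ^^ k) (\<lambda>x. f x + g x))"
    using assms(2,3) continuous_on_add[of I "(deriv ^^ k) f" "(deriv ^^ k) g"] eq
    by (auto simp: Ck_on_def cong: continuous_on_cong)
  ultimately show ?thesis by (simp add: Ck_on_def)
qed

subsection \<open>Dyadic increments\<close>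

lemma geometric_increments:
  fixes u :: "nat \<Rightarrow> real"
  assumes r: "0 \<le> r" "r < 1" and incr: "\<And>n. N \<le> n \<Longrightarrow> \<bar>u (Suc n) - u n\<bar> \<le> A * r ^ n"
  shows "convergent u" and "N \<le> n \<Longrightarrow> \<bar>lim u - u n\<bar> \<le> A * r ^ n / (1 - r)"
proof -
  have "summable (\<lambda>n. u (Suc n) - u n)"
    by (rule summable_comparison_test'[of "\<lambda>n. A * r ^ n" N])
      (use r incr in \<open>auto intro!: summable_mult summable_geometric\<close>)
  then have "convergent (\<lambda>n. u n - u 0)"
    by (simp add: summable_iff_convergent sum_lessThan_telescope)
  then show conv: "convergent u" using convergent_add[OF _ convergent_const[of "u 0"]] by force
  assume n: "N \<le> n"
  have A: "0 \<le> A * r ^ n" using incr[OF n] by linarith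
  have "\<bar>u (k + n) - u n\<bar> \<le> A * r ^ n * ((1 - r ^ k) / (1 - r))" for k
  proof (induction k)
    case (Suc k)
    have "\<bar>u (Suc k + n) - u n\<bar> \<le> A * r ^ (k + n) + A * r ^ n * ((1 - r ^ k) / (1 - r))"
      using incr[of "k + n"] n Suc by auto
    also have "\<dots> = A * r ^ n * ((1 - r ^ Suc k) / (1 - r))"
      using r by (simp add: field_simps power_add)
    finally show ?case .
  qed simp
  moreover have "A * r ^ n * ((1 - r ^ k) / (1 - r)) \<le> A * r ^ n * (1 / (1 - r))" for k
    using r A by (intro mult_left_mono divide_right_mono) auto
  ultimately have b: "\<bar>u (k + n) - u n\<bar> \<le> A * r ^ n / (1 - r)" for k
    by (force intro: order_trans)
  have "(\<lambda>k. \<bar>u (k + n) - u n\<bar>) \<longlonglongrightarrow> \<bar>lim u - u n\<bar>"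
    using conv by (intro tendsto_intros LIMSEQ_ignore_initial_segment) (simp add: convergent_LIMSEQ_iff)
  then show "\<bar>lim u - u n\<bar> \<le> A * r ^ n / (1 - r)"
    by (rule LIMSEQ_le_const2) (use b in auto)
qed

text \<open>From one level to the next this approximation either stays put or moves right by one
  step of the finer level, so only increments between neighbouring dyadic points ever occur.\<close>

definition dyadic_floor :: "nat \<Rightarrow> real \<Rightarrow> real" where
  "dyadic_floor n t = of_int \<lfloor>2 ^ n * t\<rfloor> / 2 ^ n"

lemma dyadic_floor_bounds:
  "dyadic_floor n t \<le> t" "t < dyadic_floor n t + 1 / 2 ^ n"
proof -
  have "of_int \<lfloor>2 ^ n * t\<rfloor> \<le> 2 ^ n * t" "2 ^ n * t < of_int \<lfloor>2 ^ n * t\<rfloor> + 1" by linarith+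
  then show "dyadic_floor n t \<le> t" "t < dyadic_floor n t + 1 / 2 ^ n"
    by (simp_all add: dyadic_floor_def field_simps)
qed

text \<open>Chaining. Along the floors of one point the values form a sequence with geometric
  increments, so the limit is within a geometric tail of the level-\<open>n\<close> value; two
  points at distance at most \<open>2^(-n)\<close> have equal or adjacent floors at level
  \<open>n\<close>. The constant \<open>A\<close> may depend on the window of radius
  \<open>m\<close>, since continuity is local.\<close>

lemma dyadic_increments_continuous:
  fixes f :: "real \<Rightarrow> real"
  assumes r: "0 \<le> r" "r < 1" and "open I"
    and incr: "\<And>m::nat. \<exists>A. \<forall>n. \<forall>i::int. of_int i / 2 ^ n \<in> I \<longrightarrow> (of_int i + 1) / 2 ^ n \<in> I \<longrightarrow>
      \<bar>i\<bar> \<le> int m * 2 ^ n \<longrightarrow> \<bar>f ((of_int i + 1) / 2 ^ n) - f (of_int i / 2 ^ n)\<bar> \<le> A * r ^ n"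
  shows "continuous_on I (\<lambda>t. lim (\<lambda>n. f (dyadic_floor n t)))"
proof (rule continuous_at_imp_continuous_on, intro ballI)
  fix t assume t: "t \<in> I"
  define g where "g n s = f (dyadic_floor n s)" for n s
  obtain \<epsilon> where \<epsilon>: "\<epsilon> > 0" "ball t \<epsilon> \<subseteq> I" using \<open>open I\<close> t by (meson openE)
  obtain m :: nat where m: "\<bar>t\<bar> + \<epsilon> \<le> m" by (meson real_arch_simple)
  obtain A where A: "\<And>n i. of_int i / 2 ^ n \<in> I \<Longrightarrow> (of_int i + 1) / 2 ^ n \<in> I \<Longrightarrow>
      \<bar>i\<bar> \<le> int m * 2 ^ n \<Longrightarrow> \<bar>f ((of_int i + 1) / 2 ^ n) - f (of_int i / 2 ^ n)\<bar> \<le> A * r ^ n"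
    using incr[of m] by blast
  define B where "B = \<bar>A\<bar>"
  have F: "\<bar>f ((of_int i + 1) / 2 ^ n) - f (of_int i / 2 ^ n)\<bar> \<le> B * r ^ n"
    if "\<bar>of_int i / 2 ^ n - t\<bar> < \<epsilon>" "\<bar>(of_int i + 1) / 2 ^ n - t\<bar> < \<epsilon>" for i :: int and n
  proof -
    have "\<bar>real_of_int i / 2 ^ n\<bar> \<le> m" using that m by linarith
    then have "\<bar>real_of_int i\<bar> \<le> m * 2 ^ n" by (simp add: field_simps)
    then have "real_of_int \<bar>i\<bar> \<le> real_of_int (int m * 2 ^ n)" by simp
    then have "\<bar>i\<bar> \<le> int m * 2 ^ n" by (simp only: of_int_le_iff)
    then have "\<bar>f ((of_int i + 1) / 2 ^ n) - f (of_int i / 2 ^ n)\<bar> \<le> A * r ^ n"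
      using that \<epsilon>(2) by (intro A) (auto simp: dist_real_def)
    also have "\<dots> \<le> B * r ^ n" unfolding B_def using r by (intro mult_right_mono) auto
    finally show ?thesis .
  qed
  \<comment> \<open>From level \<open>N\<close> on, the floor of a point within
    \<open>\<epsilon> / 2\<close> of \<open>t\<close> is still within \<open>\<epsilon>\<close> of
    \<open>t\<close>, hence in \<open>I\<close>.\<close>
  obtain N where N: "(1/2::real) ^ N < \<epsilon> / 2"
    using real_arch_pow_inv[of "\<epsilon> / 2" "1/2"] \<epsilon> by auto
  have Nn: "1 / 2 ^ n < \<epsilon> / 2" if "N \<le> n" for n
    using power_decreasing[OF that, of "1/2::real"] N by (simp add: power_one_over)
  have step: "\<bar>g (Suc n) s - g n s\<bar> \<le> B * r ^ n" if s: "\<bar>s - t\<bar> < \<epsilon> / 2" and n: "N \<le> n" for s n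
  proof -
    define i where "i = \<lfloor>2 ^ n * s\<rfloor>"
    have "of_int i \<le> 2 ^ n * s" "2 ^ n * s < of_int i + 1" unfolding i_def by linarith+
    then have "\<lfloor>2 * (2 ^ n * s)\<rfloor> = 2 * i \<or> \<lfloor>2 * (2 ^ n * s)\<rfloor> = 2 * i + 1" by linarith
    then consider "\<lfloor>2 ^ Suc n * s\<rfloor> = 2 * i" | "\<lfloor>2 ^ Suc n * s\<rfloor> = 2 * i + 1" by (auto simp: mult.assoc)
    then show ?thesis
    proof cases
      case 1
      then have "g (Suc n) s = g n s" by (simp add: g_def dyadic_floor_def i_def)
      then show ?thesis using r by (simp add: B_def)
    next
      case 2
      have e1: "of_int (2 * i) / 2 ^ Suc n = dyadic_floor n s" by (simp add: dyadic_floor_def i_def)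
      have e2: "(of_int (2 * i) + 1) / 2 ^ Suc n = dyadic_floor (Suc n) s" using 2 by (simp add: dyadic_floor_def)
      have h: "1 / 2 ^ Suc n < \<epsilon> / 2" "1 / 2 ^ n < \<epsilon> / 2" using Nn[of n] Nn[of "Suc n"] n by auto
      have "\<bar>g (Suc n) s - g n s\<bar> \<le> B * r ^ Suc n"
        unfolding g_def
        by (rule F[of "2 * i" "Suc n", unfolded e1 e2])
          (use s h dyadic_floor_bounds[where n=n and t=s] dyadic_floor_bounds[where n="Suc n" and t=s] in linarith)+
      also have "\<dots> \<le> B * r ^ n" using r by (intro mult_left_mono power_decreasing) (auto simp: B_def)
      finally show ?thesis .
    qed
  qed
  have close: "\<bar>g n s - g n s'\<bar> \<le> B * r ^ n"
    if s: "\<bar>s - t\<bar> < \<epsilon> / 2" "\<bar>s' - t\<bar> < \<epsilon> / 2" and n: "N \<le> n" and le: "s \<le> s'" "s' - s \<le> 1 / 2 ^ n" for s s' n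
  proof -
    define i where "i = \<lfloor>2 ^ n * s\<rfloor>"
    have "2 ^ n * s \<le> 2 ^ n * s'" "2 ^ n * s' \<le> 2 ^ n * s + 1"
      using le by (auto simp: field_simps)
    then have "\<lfloor>2 ^ n * s'\<rfloor> = i \<or> \<lfloor>2 ^ n * s'\<rfloor> = i + 1" unfolding i_def by linarith
    then show ?thesis
    proof
      assume "\<lfloor>2 ^ n * s'\<rfloor> = i"
      then show ?thesis using r by (simp add: g_def dyadic_floor_def i_def B_def)
    next
      assume i': "\<lfloor>2 ^ n * s'\<rfloor> = i + 1"
      have e1: "of_int i / 2 ^ n = dyadic_floor n s" by (simp add: dyadic_floor_def i_def)
      have e2: "(of_int i + 1) / 2 ^ n = dyadic_floor n s'" using i' by (simp add: dyadic_floor_def)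
      have "\<bar>f (dyadic_floor n s') - f (dyadic_floor n s)\<bar> \<le> B * r ^ n"
        by (rule F[of i n, unfolded e1 e2])
          (use s Nn[OF n] dyadic_floor_bounds[where n=n and t=s] dyadic_floor_bounds[where n=n and t=s'] in linarith)+
      then show ?thesis unfolding g_def by (simp add: abs_minus_commute)
    qed
  qed
  have lim: "\<bar>lim (\<lambda>n. g n s) - g n s\<bar> \<le> B * r ^ n / (1 - r)" if "\<bar>s - t\<bar> < \<epsilon> / 2" "N \<le> n" for s n
    by (rule geometric_increments(2)[OF r step[OF that(1)] that(2)])
  show "isCont (\<lambda>t. lim (\<lambda>n. f (dyadic_floor n t))) t"
    unfolding g_def[symmetric] continuous_at_eps_delta
  proof (intro allI impI)
    fix e :: real assume e: "e > 0"
    \<comment> \<open>Two geometric tails, one at each point, and one increment at level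
      \<open>n\<close> between them.\<close>
    define D where "D = 2 * B / (1 - r) + B"
    have "(\<lambda>n. D * r ^ n) \<longlonglongrightarrow> D * 0" using r by (intro tendsto_intros LIMSEQ_power_zero) auto
    then have "\<forall>\<^sub>F n in sequentially. D * r ^ n < e" using e by (auto dest: order_tendstoD(2)[of _ _ _ e])
    then obtain n\<^sub>1 where "\<And>n. n\<^sub>1 \<le> n \<Longrightarrow> D * r ^ n < e" by (auto simp: eventually_sequentially)
    then have n: "N \<le> max N n\<^sub>1" "D * r ^ max N n\<^sub>1 < e" by auto
    define n where "n = max N n\<^sub>1"
    note n = n[folded n_def]
    show "\<exists>d>0. \<forall>x'. dist x' t < d \<longrightarrow> dist (lim (\<lambda>n. g n x')) (lim (\<lambda>n. g n t)) < e"
    proof (intro exI[of _ "min (\<epsilon> / 2) (1 / 2 ^ n)"] conjI allI impI)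
      fix s assume s: "dist s t < min (\<epsilon> / 2) (1 / 2 ^ n)"
      have "\<bar>g n s - g n t\<bar> \<le> B * r ^ n"
        using close[of s t n] close[of t s n] s n \<epsilon>(1) by (cases "s \<le> t") (auto simp: dist_real_def)
      moreover have "\<bar>lim (\<lambda>n. g n s) - g n s\<bar> \<le> B * r ^ n / (1 - r)"
        "\<bar>lim (\<lambda>n. g n t) - g n t\<bar> \<le> B * r ^ n / (1 - r)"
        using s n \<epsilon>(1) by (auto intro!: lim simp: dist_real_def)
      moreover have "D * r ^ n = B * r ^ n / (1 - r) + B * r ^ n / (1 - r) + B * r ^ n"
        by (simp add: D_def algebra_simps add_divide_distrib)
      ultimately show "dist (lim (\<lambda>n. g n s)) (lim (\<lambda>n. g n t)) < e"
        using n(2) unfolding dist_real_def by linarith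
    qed (use \<epsilon>(1) in simp)
  qed
qed

lemma dyadic_floor_eventually_in:
  assumes "open I" "t \<in> I"
  obtains N where "\<And>n. N \<le> n \<Longrightarrow> dyadic_floor n t \<in> I"
proof -
  obtain \<epsilon> where \<epsilon>: "\<epsilon> > 0" "ball t \<epsilon> \<subseteq> I" using assms by (meson openE)
  obtain N where N: "(1/2::real) ^ N < \<epsilon>" using real_arch_pow_inv[of \<epsilon> "1/2"] \<epsilon> by auto
  show thesis
  proof
    fix n assume n: "N \<le> n"
    have "1 / 2 ^ n < \<epsilon>"
      using power_decreasing[OF n, of "1/2::real"] N by (simp add: power_one_over)
    then have "dyadic_floor n t \<in> ball t \<epsilon>"
      using dyadic_floor_bounds[where n=n and t=t] by (simp add: dist_real_def)
    then show "dyadic_floor n t \<in> I" using \<epsilon> by auto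
  qed
qed

subsection \<open>Processes with bounded kurtosis\<close>

lemma power4_add_le: "(x + y) ^ 4 \<le> 8 * (x ^ 4 + y ^ 4)" for x y :: real
proof -
  have sq: "(a + b)\<^sup>2 \<le> 2 * (a\<^sup>2 + b\<^sup>2)" for a b :: real
    using zero_le_power2[of "a - b"] by (simp add: power2_eq_square algebra_simps)
  have "(x + y) ^ 4 = ((x + y)\<^sup>2)\<^sup>2" by simp
  also have "\<dots> \<le> (2 * (x\<^sup>2 + y\<^sup>2))\<^sup>2" by (intro power_mono sq) auto
  also have "\<dots> = 4 * (x\<^sup>2 + y\<^sup>2)\<^sup>2" by (simp only: power_mult_distrib) simp
  also have "\<dots> \<le> 4 * (2 * ((x\<^sup>2)\<^sup>2 + (y\<^sup>2)\<^sup>2))" by (intro mult_left_mono sq) auto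
  finally show ?thesis by simp
qed

context prob_space
begin

definition L4 :: "('a \<Rightarrow> real) \<Rightarrow> bool" where
  "L4 f \<longleftrightarrow> f \<in> borel_measurable M \<and> integrable M (\<lambda>\<omega>. f \<omega> ^ 4)"

text \<open>The constant \<open>3\<close> is the kurtosis of a normal law: for a nondegenerate
  centred normal variable equality holds.\<close>

definition bounded_kurtosis :: "('a \<Rightarrow> real) \<Rightarrow> bool" where
  "bounded_kurtosis f \<longleftrightarrow>
     L4 f \<and> expectation (\<lambda>\<omega>. f \<omega> ^ 4) \<le> 3 * (expectation (\<lambda>\<omega>. f \<omega> ^ 2))\<^sup>2"

lemma L4_dominated:
  assumes "L4 g" "f \<in> borel_measurable M" "AE \<omega> in M. \<bar>f \<omega>\<bar> \<le> \<bar>g \<omega>\<bar>"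
  shows "L4 f"
  unfolding L4_def
proof
  have [measurable]: "f \<in> borel_measurable M" by fact
  show "integrable M (\<lambda>\<omega>. f \<omega> ^ 4)"
  proof (rule Bochner_Integration.integrable_bound)
    show "integrable M (\<lambda>\<omega>. g \<omega> ^ 4)" using assms(1) by (simp add: L4_def)
    show "AE \<omega> in M. norm (f \<omega> ^ 4) \<le> norm (g \<omega> ^ 4)"
      using assms(3)
    proof eventually_elim
      case (elim \<omega>)
      then have "\<bar>f \<omega>\<bar> ^ 4 \<le> \<bar>g \<omega>\<bar> ^ 4" by (intro power_mono) auto
      then show ?case by (simp add: power_abs)
    qed
  qed simp
qed fact

lemma L4_add: assumes "L4 f" "L4 g" shows "L4 (\<lambda>\<omega>. f \<omega> + g \<omega>)"
  unfolding L4_def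
proof
  have [measurable]: "f \<in> borel_measurable M" "g \<in> borel_measurable M"
    using assms by (auto simp: L4_def)
  show "(\<lambda>\<omega>. f \<omega> + g \<omega>) \<in> borel_measurable M" by simp
  show "integrable M (\<lambda>\<omega>. (f \<omega> + g \<omega>) ^ 4)"
  proof (rule Bochner_Integration.integrable_bound)
    show "integrable M (\<lambda>\<omega>. 8 * (f \<omega> ^ 4 + g \<omega> ^ 4))"
      using assms by (auto simp: L4_def)
    show "AE \<omega> in M. norm ((f \<omega> + g \<omega>) ^ 4) \<le> norm (8 * (f \<omega> ^ 4 + g \<omega> ^ 4))"
    proof (rule AE_I2)
      fix \<omega>
      have "0 \<le> (f \<omega> + g \<omega>) ^ 4" by simp
      then show "norm ((f \<omega> + g \<omega>) ^ 4) \<le> norm (8 * (f \<omega> ^ 4 + g \<omega> ^ 4))"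
        using power4_add_le[of "f \<omega>" "g \<omega>"] by simp
    qed
  qed simp
qed

lemma L4_cmult: assumes "L4 f" shows "L4 (\<lambda>\<omega>. c * f \<omega>)"
  using assms by (auto simp: L4_def power_mult_distrib)

lemma L4_lincomb: assumes "L4 f" "L4 g" shows "L4 (\<lambda>\<omega>. a * f \<omega> + b * g \<omega>)"
  by (intro L4_add L4_cmult assms)

lemma L4_diff: assumes "L4 f" "L4 g" shows "L4 (\<lambda>\<omega>. f \<omega> - g \<omega>)"
  using L4_lincomb[OF assms, of 1 "-1"] by simp

lemma L4_integrable_mult:
  assumes "L4 f" "L4 g" shows "integrable M (\<lambda>\<omega>. f \<omega> * g \<omega>)"
proof (rule Bochner_Integration.integrable_bound)
  have [measurable]: "f \<in> borel_measurable M" "g \<in> borel_measurable M"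
    using assms by (auto simp: L4_def)
  show "integrable M (\<lambda>\<omega>. 1 + f \<omega> ^ 4 + g \<omega> ^ 4)" using assms by (auto simp: L4_def)
  show "(\<lambda>\<omega>. f \<omega> * g \<omega>) \<in> borel_measurable M" by simp
  show "AE \<omega> in M. norm (f \<omega> * g \<omega>) \<le> norm (1 + f \<omega> ^ 4 + g \<omega> ^ 4)"
  proof (rule AE_I2)
    fix \<omega>
    have p: "z\<^sup>2 \<le> (1 + z ^ 4) / 2" for z :: real
      using zero_le_power2[of "z\<^sup>2 - 1"] by (simp add: power2_diff)
    have sq_sum: "0 \<le> u \<Longrightarrow> 0 \<le> v \<Longrightarrow> a \<le> (1 + u) / 2 \<Longrightarrow> b \<le> (1 + v) / 2 \<Longrightarrow> a + b \<le> 1 + u + v"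
      for a b u v :: real by (simp add: field_simps)
    have "\<bar>f \<omega> * g \<omega>\<bar> \<le> (f \<omega>)\<^sup>2 + (g \<omega>)\<^sup>2"
      using zero_le_power2[of "\<bar>f \<omega>\<bar> - \<bar>g \<omega>\<bar>"] zero_le_power2[of "f \<omega>"] zero_le_power2[of "g \<omega>"]
      unfolding power2_diff abs_mult power2_abs by linarith
    also have "\<dots> \<le> 1 + f \<omega> ^ 4 + g \<omega> ^ 4"
      by (rule sq_sum[OF _ _ p p]) simp_all
    finally show "norm (f \<omega> * g \<omega>) \<le> norm (1 + f \<omega> ^ 4 + g \<omega> ^ 4)" by simp
  qed
qed

lemma L4_integrable_power2: "L4 f \<Longrightarrow> integrable M (\<lambda>\<omega>. (f \<omega>)\<^sup>2)"
  using L4_integrable_mult[of f f] by (simp add: power2_eq_square)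

lemma L4_sqrt_sqrt:
  assumes [measurable]: "A \<in> borel_measurable M" and "integrable M A" "\<And>\<omega>. 0 \<le> A \<omega>"
  shows "L4 (\<lambda>\<omega>. sqrt (sqrt (A \<omega>)))"
proof -
  have "sqrt (sqrt (A \<omega>)) ^ 4 = A \<omega>" for \<omega>
  proof -
    have "sqrt (sqrt (A \<omega>)) ^ 4 = ((sqrt (sqrt (A \<omega>)))\<^sup>2)\<^sup>2" by simp
    then show ?thesis using assms(3)[of \<omega>] by (simp del: power_mult)
  qed
  then show ?thesis using assms by (simp add: L4_def)
qed

section \<open>Almost sure summability and dominated limits\<close>

text \<open>Monotone convergence exchanges sum and expectation, and a nonnegative variable with
  finite expectation is almost surely finite. This takes the place of a Borel-Cantelli argument
  throughout.\<close>

lemma AE_summable_integrable: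
  fixes f :: "nat \<Rightarrow> 'a \<Rightarrow> real"
  assumes int: "\<And>n. integrable M (f n)" and pos: "\<And>n \<omega>. 0 \<le> f n \<omega>"
    and bound: "\<And>n. expectation (f n) \<le> c n" and "summable c"
  shows "AE \<omega> in M. summable (\<lambda>n. f n \<omega>)" "integrable M (\<lambda>\<omega>. \<Sum>n. f n \<omega>)"
proof -
  have [measurable]: "\<And>n. f n \<in> borel_measurable M" using int by auto
  have E0: "0 \<le> expectation (f n)" for n using pos by simp
  have sE: "summable (\<lambda>n. expectation (f n))"
    by (rule summable_comparison_test'[OF \<open>summable c\<close>, of 0]) (use E0 bound in auto)
  have "(\<integral>\<^sup>+ \<omega>. (\<Sum>n. ennreal (f n \<omega>)) \<partial>M) = (\<Sum>n. \<integral>\<^sup>+ \<omega>. ennreal (f n \<omega>) \<partial>M)"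
    by (rule nn_integral_suminf) simp
  also have "\<dots> = (\<Sum>n. ennreal (expectation (f n)))"
    by (intro suminf_cong nn_integral_eq_integral int) (simp add: pos)
  also have "\<dots> = ennreal (\<Sum>n. expectation (f n))"
    by (rule suminf_ennreal2) (use E0 sE in auto)
  finally have "(\<integral>\<^sup>+ \<omega>. (\<Sum>n. ennreal (f n \<omega>)) \<partial>M) \<noteq> \<infinity>" by simp
  then have "AE \<omega> in M. (\<Sum>n. ennreal (f n \<omega>)) \<noteq> \<infinity>"
    by (intro nn_integral_PInf_AE) simp_all
  then show *: "AE \<omega> in M. summable (\<lambda>n. f n \<omega>)"
    by eventually_elim (auto intro!: summable_suminf_not_top simp: pos)
  show "integrable M (\<lambda>\<omega>. \<Sum>n. f n \<omega>)"
    by (rule integrable_suminf[OF int]) (use * sE pos in \<open>simp_all add: abs_of_nonneg\<close>)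
qed

text \<open>The almost sure limit is dominated because each increment is at most \<open>(3/4)^n\<close> times the
  fourth root of the weighted sum of the fourth powers of all increments.\<close>

lemma L4_fast_convergent:
  fixes f :: "nat \<Rightarrow> 'a \<Rightarrow> real"
  assumes f: "\<And>n. L4 (f n)"
    and bound: "\<And>n. expectation (\<lambda>\<omega>. (f (Suc n) \<omega> - f n \<omega>) ^ 4) \<le> C * (1/4) ^ n"
  obtains W where "L4 W" "\<And>n. AE \<omega> in M. \<bar>f n \<omega>\<bar> \<le> W \<omega>" "AE \<omega> in M. convergent (\<lambda>n. f n \<omega>)"
proof -
  \<comment> \<open>\<open>256/81 = (4/3)^4\<close>\<close>
  define a where "a n \<omega> = (256/81) ^ n * (f (Suc n) \<omega> - f n \<omega>) ^ 4" for n \<omega>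
  define A where "A \<omega> = (\<Sum>n. a n \<omega>)" for \<omega>
  \<comment> \<open>\<open>max\<close> guards against the junk value of the sum where it diverges.\<close>
  define B where "B \<omega> = sqrt (sqrt (max 0 (A \<omega>)))" for \<omega>
  have int: "integrable M (a n)" for n
    using L4_diff[OF f[of "Suc n"] f[of n]] unfolding a_def L4_def by auto
  have [measurable]: "a n \<in> borel_measurable M" for n using int by auto
  have pos: "0 \<le> a n \<omega>" for n \<omega> by (simp add: a_def)
  \<comment> \<open>The weights are admissible because
    \<open>(256/81) * (1/4) = 64/81 < 1\<close>.\<close>
  have "expectation (a n) \<le> C * (64/81) ^ n" for n
  proof -
    have "expectation (a n) = (256/81) ^ n * expectation (\<lambda>\<omega>. (f (Suc n) \<omega> - f n \<omega>) ^ 4)"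
      by (simp add: a_def[abs_def])
    also have "\<dots> \<le> (256/81) ^ n * (C * (1/4) ^ n)"
      by (intro mult_left_mono bound) auto
    also have "\<dots> = C * ((256/81) * (1/4)) ^ n"
      by (simp only: power_mult_distrib mult_ac)
    finally show ?thesis by simp
  qed
  moreover have "summable (\<lambda>n. C * (64/81) ^ n)" by (intro summable_mult summable_geometric) auto
  ultimately have summ: "AE \<omega> in M. summable (\<lambda>n. a n \<omega>)" and intA: "integrable M A"
    unfolding A_def by (fact AE_summable_integrable[OF int pos])+
  have [measurable]: "A \<in> borel_measurable M" using intA by auto
  have B: "L4 B" unfolding B_def by (rule L4_sqrt_sqrt) (use intA in auto)
  have incr: "AE \<omega> in M. \<forall>n. \<bar>f (Suc n) \<omega> - f n \<omega>\<bar> \<le> (3/4) ^ n * B \<omega>"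
    using summ
  proof eventually_elim
    case (elim \<omega>)
    have A0: "0 \<le> A \<omega>" unfolding A_def by (rule suminf_nonneg[OF elim]) (rule pos)
    have B0: "0 \<le> B \<omega>" by (simp add: B_def)
    have "B \<omega> ^ 4 = ((B \<omega>)\<^sup>2)\<^sup>2" by simp
    then have B4: "B \<omega> ^ 4 = A \<omega>" using A0 by (simp add: B_def del: power_mult)
    show ?case
    proof
      fix n
      have "a n \<omega> \<le> A \<omega>"
        unfolding A_def using sum_le_suminf[OF elim, of "{n}"] pos by simp
      then have "(81/256) ^ n * a n \<omega> \<le> (81/256) ^ n * B \<omega> ^ 4"
        unfolding B4 by (intro mult_left_mono) auto
      moreover have "(81/256) ^ n * (a n \<omega>) = ((81/256) * (256/81)) ^ n * (f (Suc n) \<omega> - f n \<omega>) ^ 4"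
        by (simp only: a_def power_mult_distrib mult_ac)
      ultimately have "\<bar>f (Suc n) \<omega> - f n \<omega>\<bar> ^ 4 \<le> (81/256) ^ n * B \<omega> ^ 4"
        by simp
      also have "\<dots> = ((3/4) ^ n * B \<omega>) ^ 4"
      proof -
        have "(81/256 :: real) ^ n = ((3/4) ^ 4) ^ n" by (simp add: power_divide)
        also have "\<dots> = ((3/4) ^ n) ^ 4" by (simp only: power_mult[symmetric] mult.commute)
        finally show ?thesis by (simp only: power_mult_distrib)
      qed
      finally have "\<bar>f (Suc n) \<omega> - f n \<omega>\<bar> ^ Suc 3 \<le> ((3/4) ^ n * B \<omega>) ^ Suc 3" by simp
      then show "\<bar>f (Suc n) \<omega> - f n \<omega>\<bar> \<le> (3/4) ^ n * B \<omega>"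
        by (rule power_le_imp_le_base) (use B0 in auto)
    qed
  qed
  \<comment> \<open>\<open>4\<close> is the sum of the geometric series with ratio
    \<open>3/4\<close>.\<close>
  define W where "W \<omega> = \<bar>f 0 \<omega>\<bar> + 4 * B \<omega>" for \<omega>
  show thesis
  proof
    have "L4 (\<lambda>\<omega>. \<bar>f 0 \<omega>\<bar>)"
      using f[of 0] by (intro L4_dominated[OF f[of 0]]) (auto simp: L4_def)
    then show "L4 W" unfolding W_def by (intro L4_add L4_cmult B)
    show "AE \<omega> in M. \<bar>f n \<omega>\<bar> \<le> W \<omega>" for n
      using incr
    proof eventually_elim
      case (elim \<omega>)
      have B0: "0 \<le> B \<omega>" by (simp add: B_def)
      have "\<bar>f n \<omega>\<bar> \<le> \<bar>f 0 \<omega>\<bar> + (4 - 4 * (3/4) ^ n) * B \<omega>"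
      proof (induction n)
        case (Suc n)
        have "\<bar>f (Suc n) \<omega>\<bar> \<le> \<bar>f n \<omega>\<bar> + (3/4) ^ n * B \<omega>" using elim[rule_format, of n] by linarith
        also have "\<dots> \<le> \<bar>f 0 \<omega>\<bar> + (4 - 4 * (3/4) ^ n) * B \<omega> + (3/4) ^ n * B \<omega>" using Suc by simp
        also have "\<dots> = \<bar>f 0 \<omega>\<bar> + (4 - 4 * (3/4) ^ Suc n) * B \<omega>" by (simp add: algebra_simps)
        finally show ?case .
      qed simp
      also have "\<dots> \<le> W \<omega>" using B0 unfolding W_def by (intro add_left_mono mult_right_mono) auto
      finally show ?case .
    qed
    show "AE \<omega> in M. convergent (\<lambda>n. f n \<omega>)"
      using incr
    proof eventually_elim
      case (elim \<omega>)
      have "summable (\<lambda>n. (3/4) ^ n * B \<omega>)" by (intro summable_mult2 summable_geometric) auto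
      then have "summable (\<lambda>n. f (Suc n) \<omega> - f n \<omega>)"
        by (rule summable_comparison_test'[of _ 0]) (use elim in auto)
      then have "convergent (\<lambda>n. \<Sum>i<n. f (Suc i) \<omega> - f i \<omega>)" by (simp add: summable_iff_convergent)
      then have "convergent (\<lambda>n. f n \<omega> - f 0 \<omega>)" by (simp add: sum_lessThan_telescope[of "\<lambda>i. f i \<omega>"])
      then show ?case using convergent_add[OF _ convergent_const[of "f 0 \<omega>"]] by force
    qed
  qed
qed

text \<open>With an almost sure limit and a majorant in \<open>L4\<close>, dominated convergence
  applies at once to second moments, fourth moments and covariances, which are all that has to
  survive the limit.\<close>

definition dominated_limit :: "(nat \<Rightarrow> 'a \<Rightarrow> real) \<Rightarrow> ('a \<Rightarrow> real) \<Rightarrow> bool" where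
  "dominated_limit f g \<longleftrightarrow> (\<forall>n. L4 (f n)) \<and> g \<in> borel_measurable M \<and>
     (AE \<omega> in M. (\<lambda>n. f n \<omega>) \<longlonglongrightarrow> g \<omega>) \<and>
     (\<exists>W. L4 W \<and> (\<forall>n. AE \<omega> in M. \<bar>f n \<omega>\<bar> \<le> W \<omega>))"

lemma dominated_limit_L4:
  assumes "dominated_limit f g" shows "L4 g"
proof -
  obtain W where W: "L4 W" "\<And>n. AE \<omega> in M. \<bar>f n \<omega>\<bar> \<le> W \<omega>"
    and lim: "AE \<omega> in M. (\<lambda>n. f n \<omega>) \<longlonglongrightarrow> g \<omega>" and g: "g \<in> borel_measurable M"
    using assms by (auto simp: dominated_limit_def)
  have "AE \<omega> in M. \<forall>n. \<bar>f n \<omega>\<bar> \<le> W \<omega>" using W(2) by (simp add: AE_all_countable)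
  with lim have "AE \<omega> in M. \<bar>g \<omega>\<bar> \<le> \<bar>W \<omega>\<bar>"
  proof eventually_elim
    case (elim \<omega>)
    have "\<bar>g \<omega>\<bar> \<le> W \<omega>"
      by (rule LIMSEQ_le_const2[OF tendsto_rabs[OF elim(1)]]) (use elim(2) in auto)
    then show ?case by simp
  qed
  then show ?thesis by (rule L4_dominated[OF W(1) g])
qed

lemma dominated_limit_mult:
  assumes "dominated_limit f g" "L4 h"
  shows "(\<lambda>n. expectation (\<lambda>\<omega>. f n \<omega> * h \<omega>)) \<longlonglongrightarrow> expectation (\<lambda>\<omega>. g \<omega> * h \<omega>)"
proof -
  obtain W where W: "L4 W" "\<And>n. AE \<omega> in M. \<bar>f n \<omega>\<bar> \<le> W \<omega>"
    and lim: "AE \<omega> in M. (\<lambda>n. f n \<omega>) \<longlonglongrightarrow> g \<omega>"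
    and [measurable]: "g \<in> borel_measurable M" "\<And>n. f n \<in> borel_measurable M" "h \<in> borel_measurable M"
    using assms by (auto simp: dominated_limit_def L4_def)
  show ?thesis
  proof (rule integral_dominated_convergence)
    show "integrable M (\<lambda>\<omega>. \<bar>W \<omega> * h \<omega>\<bar>)"
      by (intro integrable_abs L4_integrable_mult W assms)
    show "AE \<omega> in M. (\<lambda>n. f n \<omega> * h \<omega>) \<longlonglongrightarrow> g \<omega> * h \<omega>"
      using lim by eventually_elim (intro tendsto_intros)
    show "AE \<omega> in M. norm (f n \<omega> * h \<omega>) \<le> \<bar>W \<omega> * h \<omega>\<bar>" for n
      using W(2)[of n] by eventually_elim (auto simp: abs_mult intro!: mult_right_mono)
  qed auto
qed

lemma dominated_limit_power:
  assumes "dominated_limit f g" and k: "k = 2 \<or> k = 4"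
  shows "(\<lambda>n. expectation (\<lambda>\<omega>. f n \<omega> ^ k)) \<longlonglongrightarrow> expectation (\<lambda>\<omega>. g \<omega> ^ k)"
proof -
  obtain W where W: "L4 W" "\<And>n. AE \<omega> in M. \<bar>f n \<omega>\<bar> \<le> W \<omega>"
    and lim: "AE \<omega> in M. (\<lambda>n. f n \<omega>) \<longlonglongrightarrow> g \<omega>"
    and [measurable]: "g \<in> borel_measurable M" "\<And>n. f n \<in> borel_measurable M"
    using assms by (auto simp: dominated_limit_def L4_def)
  show ?thesis
  proof (rule integral_dominated_convergence)
    show "integrable M (\<lambda>\<omega>. W \<omega> ^ k)"
      using k W(1) L4_integrable_power2[OF W(1)] by (auto simp: L4_def)
    show "AE \<omega> in M. (\<lambda>n. f n \<omega> ^ k) \<longlonglongrightarrow> g \<omega> ^ k"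
      using lim by eventually_elim (intro tendsto_intros)
    show "AE \<omega> in M. norm (f n \<omega> ^ k) \<le> W \<omega> ^ k" for n
      using W(2)[of n] by eventually_elim (auto simp: power_abs intro!: power_mono)
  qed auto
qed

lemma bounded_kurtosis_limit:
  assumes lim: "dominated_limit f g" and f: "\<And>n. bounded_kurtosis (f n)"
  shows "bounded_kurtosis g"
  unfolding bounded_kurtosis_def
proof
  show "L4 g" by (rule dominated_limit_L4[OF lim])
  show "expectation (\<lambda>\<omega>. g \<omega> ^ 4) \<le> 3 * (expectation (\<lambda>\<omega>. g \<omega> ^ 2))\<^sup>2"
  proof (rule LIMSEQ_le)
    show "(\<lambda>n. expectation (\<lambda>\<omega>. f n \<omega> ^ 4)) \<longlonglongrightarrow> expectation (\<lambda>\<omega>. g \<omega> ^ 4)"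
      by (rule dominated_limit_power[OF lim]) simp
    show "(\<lambda>n. 3 * (expectation (\<lambda>\<omega>. f n \<omega> ^ 2))\<^sup>2) \<longlonglongrightarrow> 3 * (expectation (\<lambda>\<omega>. g \<omega> ^ 2))\<^sup>2"
      by (intro tendsto_intros dominated_limit_power[OF lim]) simp
  qed (use f in \<open>auto simp: bounded_kurtosis_def\<close>)
qed

lemma dominated_limit_lincomb:
  assumes f: "dominated_limit f f'" and g: "dominated_limit g g'"
  shows "dominated_limit (\<lambda>n \<omega>. a * f n \<omega> + b * g n \<omega>) (\<lambda>\<omega>. a * f' \<omega> + b * g' \<omega>)"
proof -
  obtain V W where V: "L4 V" "\<And>n. AE \<omega> in M. \<bar>f n \<omega>\<bar> \<le> V \<omega>"
    and W: "L4 W" "\<And>n. AE \<omega> in M. \<bar>g n \<omega>\<bar> \<le> W \<omega>"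
    using f g by (auto simp: dominated_limit_def)
  have lf: "AE \<omega> in M. (\<lambda>n. f n \<omega>) \<longlonglongrightarrow> f' \<omega>" and lg: "AE \<omega> in M. (\<lambda>n. g n \<omega>) \<longlonglongrightarrow> g' \<omega>"
    and [measurable]: "f' \<in> borel_measurable M" "g' \<in> borel_measurable M"
    and L: "\<And>n. L4 (f n)" "\<And>n. L4 (g n)"
    using f g by (auto simp: dominated_limit_def)
  show ?thesis
    unfolding dominated_limit_def
  proof (intro conjI allI exI)
    show "L4 (\<lambda>\<omega>. a * f n \<omega> + b * g n \<omega>)" for n by (intro L4_lincomb L)
    show "AE \<omega> in M. (\<lambda>n. a * f n \<omega> + b * g n \<omega>) \<longlonglongrightarrow> a * f' \<omega> + b * g' \<omega>"
      using lf lg by eventually_elim (intro tendsto_intros)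
    show "L4 (\<lambda>\<omega>. \<bar>a\<bar> * V \<omega> + \<bar>b\<bar> * W \<omega>)" by (intro L4_lincomb V W)
    show "AE \<omega> in M. \<bar>a * f n \<omega> + b * g n \<omega>\<bar> \<le> \<bar>a\<bar> * V \<omega> + \<bar>b\<bar> * W \<omega>" for n
      using V(2)[of n] W(2)[of n]
    proof eventually_elim
      case (elim \<omega>)
      have "\<bar>a * f n \<omega>\<bar> \<le> \<bar>a\<bar> * V \<omega>" "\<bar>b * g n \<omega>\<bar> \<le> \<bar>b\<bar> * W \<omega>"
        using elim by (auto simp: abs_mult intro!: mult_left_mono)
      then show ?case by linarith
    qed
  qed simp
qed

section \<open>Continuous modifications from fourth moments\<close>

text \<open>The Kolmogorov-Chentsov theorem for the exponents \<open>4\<close> and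
  \<open>2 = 1 + 1\<close>. The modification is the limit of the process along dyadic floors;
  summability of weighted fourth powers of the increments supplies the geometric bounds that
  chaining needs.\<close>

lemma continuous_modification:
  fixes X :: "real \<Rightarrow> 'a \<Rightarrow> real"
  assumes "open I" and meas: "\<And>z. z \<in> I \<Longrightarrow> X z \<in> borel_measurable M"
    and L4: "\<And>s t. s \<in> I \<Longrightarrow> t \<in> I \<Longrightarrow> L4 (\<lambda>\<omega>. X s \<omega> - X t \<omega>)"
    and bound: "\<And>s t. s \<in> I \<Longrightarrow> t \<in> I \<Longrightarrow>
      expectation (\<lambda>\<omega>. (X s \<omega> - X t \<omega>) ^ 4) \<le> C * (s - t)\<^sup>2"
  obtains Y where "\<And>z. z \<in> I \<Longrightarrow> Y z \<in> borel_measurable M"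
    "\<And>z. z \<in> I \<Longrightarrow> AE \<omega> in M. Y z \<omega> = X z \<omega>"
    "\<And>\<omega>. continuous_on I (\<lambda>z. Y z \<omega>)"
proof -
  \<comment> \<open>A bounded window keeps the number of increments at level \<open>n\<close> below
    a multiple of \<open>2^n\<close>. There are countably many windows, so a single null set serves
    all of them.\<close>
  define P where "P m n = {i::int. \<bar>i\<bar> \<le> int m * 2 ^ n \<and> of_int i / 2 ^ n \<in> I \<and> (of_int i + 1) / 2 ^ n \<in> I}" for m n :: nat
  have Psub: "P m n \<subseteq> {- (int m * 2 ^ n) .. int m * 2 ^ n}" for m n by (auto simp: P_def)
  have fin: "finite (P m n)" for m n by (rule finite_subset[OF Psub]) simp
  have card: "real (card (P m n)) \<le> real (2 * m + 1) * 2 ^ n" for m n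
  proof -
    have "0 \<le> int m * 2 ^ n" by simp
    then have "int (card (P m n)) \<le> 2 * (int m * 2 ^ n) + 1"
      using card_mono[OF _ Psub[of m n]] by (simp add: nat_le_iff le_nat_iff del: zero_le_mult_iff)
    then have "real_of_int (int (card (P m n))) \<le> real_of_int (2 * (int m * 2 ^ n) + 1)"
      by (simp only: of_int_le_iff)
    then have "real (card (P m n)) \<le> 2 * (m * 2 ^ n) + 1" by simp
    also have "\<dots> \<le> real (2 * m + 1) * 2 ^ n" by (simp add: algebra_simps)
    finally show ?thesis .
  qed
  \<comment> \<open>\<open>10000/6561 = (10/9)^4\<close>; summability of the means needs \<open>(10/9)^4 < 2\<close>, as level \<open>n\<close> has about
     \<open>2^n\<close> increments with fourth moment of order \<open>4^(-n)\<close>.\<close>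
  define a where "a m n \<omega> = (\<Sum>i\<in>P m n. (10000/6561) ^ n * (X ((of_int i + 1) / 2 ^ n) \<omega> - X (of_int i / 2 ^ n) \<omega>) ^ 4)"
    for m n \<omega>
  have int: "integrable M (\<lambda>\<omega>. (X s \<omega> - X t \<omega>) ^ 4)" if "s \<in> I" "t \<in> I" for s t
    using L4[OF that] by (simp add: L4_def)
  have inta: "integrable M (a m n)" for m n
    unfolding a_def by (intro Bochner_Integration.integrable_sum integrable_mult_right int) (auto simp: P_def)
  have Ea: "expectation (a m n) \<le> (real (2 * m + 1) * \<bar>C\<bar>) * (5000/6561) ^ n" for m n
  proof -
    have "expectation (a m n) = (\<Sum>i\<in>P m n. (10000/6561) ^ n *
        expectation (\<lambda>\<omega>. (X ((of_int i + 1) / 2 ^ n) \<omega> - X (of_int i / 2 ^ n) \<omega>) ^ 4))"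
      unfolding a_def
      by (subst Bochner_Integration.integral_sum)
        (auto simp: P_def intro!: integrable_mult_right int)
    also have "\<dots> \<le> (\<Sum>i\<in>P m n. (10000/6561) ^ n * (\<bar>C\<bar> * (1/4) ^ n))"
    proof (intro sum_mono mult_left_mono)
      fix i assume "i \<in> P m n"
      then have I: "(of_int i + 1) / 2 ^ n \<in> I" "of_int i / 2 ^ n \<in> I" by (auto simp: P_def)
      have "expectation (\<lambda>\<omega>. (X ((of_int i + 1) / 2 ^ n) \<omega> - X (of_int i / 2 ^ n) \<omega>) ^ 4)
        \<le> C * ((of_int i + 1) / 2 ^ n - of_int i / 2 ^ n)\<^sup>2" by (rule bound[OF I])
      also have "(of_int i + 1) / 2 ^ n - of_int i / 2 ^ n = (1 / 2 :: real) ^ n" by (simp add: field_simps power_divide)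
      also have "((1 / 2 :: real) ^ n)\<^sup>2 = (1/4) ^ n"
        by (simp add: power2_eq_square flip: power_mult_distrib)
      also have "C * (1/4) ^ n \<le> \<bar>C\<bar> * (1/4) ^ n" by (intro mult_right_mono) auto
      finally show "expectation (\<lambda>\<omega>. (X ((of_int i + 1) / 2 ^ n) \<omega> - X (of_int i / 2 ^ n) \<omega>) ^ 4) \<le> \<bar>C\<bar> * (1/4) ^ n" .
    qed auto
    also have "\<dots> = card (P m n) * ((10000/6561) ^ n * (\<bar>C\<bar> * (1/4) ^ n))" by simp
    also have "\<dots> \<le> (real (2 * m + 1) * 2 ^ n) * ((10000/6561) ^ n * (\<bar>C\<bar> * (1/4) ^ n))"
      by (intro mult_right_mono card) auto
    also have "\<dots> = (real (2 * m + 1) * \<bar>C\<bar>) * (2 * (10000/6561) * (1/4)) ^ n"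
      by (simp only: power_mult_distrib mult_ac)
    finally show ?thesis by simp
  qed
  have "AE \<omega> in M. summable (\<lambda>n. a m n \<omega>)" for m
  proof (rule AE_summable_integrable[OF inta _ Ea])
    show "0 \<le> a m n \<omega>" for n \<omega> unfolding a_def by (intro sum_nonneg) auto
    show "summable (\<lambda>n. (real (2 * m + 1) * \<bar>C\<bar>) * (5000/6561) ^ n)"
      by (intro summable_mult summable_geometric) auto
  qed
  then have "AE \<omega> in M. \<forall>m. summable (\<lambda>n. a m n \<omega>)" by (simp add: AE_all_countable)
  then obtain N where N: "N \<in> null_sets M" "\<And>\<omega>. \<omega> \<in> space M \<Longrightarrow> \<omega> \<notin> N \<Longrightarrow> \<forall>m. summable (\<lambda>n. a m n \<omega>)"
    by (auto simp: eventually_ae_filter)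
  \<comment> \<open>At coarse levels the floor of a point of \<open>I\<close> can lie outside
    \<open>I\<close>, where nothing is known about \<open>X\<close>; the value \<open>0\<close>
    there keeps the limit measurable.\<close>
  define X0 where "X0 z \<omega> = (if z \<in> I then X z \<omega> else 0)" for z \<omega>
  have X0[measurable]: "X0 z \<in> borel_measurable M" for z
    unfolding X0_def using meas by (cases "z \<in> I") auto
  \<comment> \<open>Setting the paths to \<open>0\<close> on the exceptional set makes every path
    continuous, not just almost every one.\<close>
  define Y where "Y z \<omega> = indicator (space M - N) \<omega> * lim (\<lambda>n. X0 (dyadic_floor n z) \<omega>)" for z \<omega>
  show thesis
  proof
    have "space M - N \<in> sets M" using N by auto
    then show "Y z \<in> borel_measurable M" for z
      unfolding Y_def
      by (intro borel_measurable_times borel_measurable_indicator borel_measurable_lim_metric X0)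
    show "continuous_on I (\<lambda>z. Y z \<omega>)" for \<omega>
    proof (cases "\<omega> \<in> space M - N")
      case True
      have "continuous_on I (\<lambda>t. lim (\<lambda>n. X0 (dyadic_floor n t) \<omega>))"
      proof (rule dyadic_increments_continuous[of "9/10"])
        fix m
        have summ: "summable (\<lambda>n. a m n \<omega>)" using N True by auto
        have apos: "0 \<le> a m n \<omega>" for n unfolding a_def by (intro sum_nonneg) auto
        define S where "S = (\<Sum>n. a m n \<omega>)"
        have S0: "0 \<le> S" unfolding S_def by (intro suminf_nonneg summ apos)
        have "\<bar>X0 ((of_int i + 1) / 2 ^ n) \<omega> - X0 (of_int i / 2 ^ n) \<omega>\<bar> \<le> (1 + S) * (9/10) ^ n"
          if "of_int i / 2 ^ n \<in> I" "(of_int i + 1) / 2 ^ n \<in> I" "\<bar>i\<bar> \<le> int m * 2 ^ n" for n i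
        proof -
          let ?d = "X ((of_int i + 1) / 2 ^ n) \<omega> - X (of_int i / 2 ^ n) \<omega>"
          have "i \<in> P m n" using that by (auto simp: P_def)
          then have "(10000/6561) ^ n * ?d ^ 4 \<le> a m n \<omega>"
            unfolding a_def by (intro member_le_sum[OF _ _ fin]) auto
          also have "\<dots> \<le> S"
            unfolding S_def using sum_le_suminf[OF summ, of "{n}"] apos by simp
          \<comment> \<open>A crude replacement for the fourth root of \<open>S\<close>; any finite
            constant will do for the path bound.\<close>
          also have "\<dots> \<le> (1 + S) ^ 4" using S0 self_le_power[of "1 + S" 4] by simp
          finally have "(6561/10000) ^ n * ((10000/6561) ^ n * ?d ^ 4) \<le> (6561/10000) ^ n * (1 + S) ^ 4"
            by (intro mult_left_mono) auto
          also have "(6561/10000) ^ n * ((10000/6561) ^ n * ?d ^ 4) = ((6561/10000) * (10000/6561)) ^ n * ?d ^ 4"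
            by (simp only: power_mult_distrib mult_ac)
          finally have "\<bar>?d\<bar> ^ 4 \<le> (6561/10000) ^ n * (1 + S) ^ 4" by simp
          also have "\<dots> = ((1 + S) * (9/10) ^ n) ^ 4"
          proof -
            have "(6561/10000 :: real) ^ n = ((9/10) ^ 4) ^ n" by (simp add: power_divide)
            also have "\<dots> = ((9/10) ^ n) ^ 4" by (simp only: power_mult[symmetric] mult.commute)
            finally show ?thesis by (simp only: power_mult_distrib mult.commute)
          qed
          finally have "\<bar>?d\<bar> ^ Suc 3 \<le> ((1 + S) * (9/10) ^ n) ^ Suc 3" by simp
          then have "\<bar>?d\<bar> \<le> (1 + S) * (9/10) ^ n"
            by (rule power_le_imp_le_base) (use S0 in auto)
          then show ?thesis using that by (simp add: X0_def)
        qed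
        then show "\<exists>A. \<forall>n. \<forall>i::int. of_int i / 2 ^ n \<in> I \<longrightarrow> (of_int i + 1) / 2 ^ n \<in> I \<longrightarrow>
          \<bar>i\<bar> \<le> int m * 2 ^ n \<longrightarrow>
          \<bar>X0 ((of_int i + 1) / 2 ^ n) \<omega> - X0 (of_int i / 2 ^ n) \<omega>\<bar> \<le> A * (9/10) ^ n"
          by blast
      qed (use \<open>open I\<close> in auto)
      then show ?thesis using True by (simp add: Y_def)
    qed (simp add: Y_def)
    show "AE \<omega> in M. Y t \<omega> = X t \<omega>" if t: "t \<in> I" for t
    proof -
      \<comment> \<open>From level \<open>K\<close> on the floors lie in \<open>I\<close>, and the
        fourth moments of the distance to \<open>X t\<close> decay like \<open>4^(-n)\<close>. They
        are summable, so the values at the floors tend to \<open>X t\<close> almost surely, and the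
        limit defining \<open>Y t\<close> is the same sequence.\<close>
      obtain K where K: "\<And>n. K \<le> n \<Longrightarrow> dyadic_floor n t \<in> I"
        using dyadic_floor_eventually_in[OF \<open>open I\<close> t] by blast
      have E: "expectation (\<lambda>\<omega>. (X (dyadic_floor (n + K) t) \<omega> - X t \<omega>) ^ 4) \<le> \<bar>C\<bar> * (1/4) ^ n" for n
      proof -
        have "expectation (\<lambda>\<omega>. (X (dyadic_floor (n + K) t) \<omega> - X t \<omega>) ^ 4) \<le> C * (dyadic_floor (n + K) t - t)\<^sup>2"
          by (intro bound K t) simp
        also have "\<dots> \<le> \<bar>C\<bar> * ((1 / 2) ^ n)\<^sup>2"
        proof (intro mult_mono)
          have "1 / 2 ^ (n + K) \<le> (1 / 2 :: real) ^ n"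
            using power_decreasing[of n "n + K" "1/2::real"] by (simp add: power_one_over)
          then have "\<bar>dyadic_floor (n + K) t - t\<bar> \<le> \<bar>(1 / 2) ^ n\<bar>"
            using dyadic_floor_bounds[where n="n + K" and t=t] by auto
          then show "(dyadic_floor (n + K) t - t)\<^sup>2 \<le> ((1 / 2) ^ n)\<^sup>2" by (simp only: abs_le_square_iff)
        qed auto
        also have "((1 / 2 :: real) ^ n)\<^sup>2 = (1/4) ^ n"
          by (simp add: power2_eq_square flip: power_mult_distrib)
        finally show ?thesis .
      qed
      have "AE \<omega> in M. summable (\<lambda>n. (X (dyadic_floor (n + K) t) \<omega> - X t \<omega>) ^ 4)"
        by (rule AE_summable_integrable[OF int _ E])
          (use K t in \<open>auto intro!: summable_mult summable_geometric\<close>)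
      moreover have "AE \<omega> in M. \<omega> \<notin> N" using N(1) by (rule AE_not_in)
      ultimately show ?thesis
        using AE_space
      proof eventually_elim
        case (elim \<omega>)
        let ?d = "\<lambda>n. X (dyadic_floor (n + K) t) \<omega> - X t \<omega>"
        have "(\<lambda>n. sqrt (sqrt (?d n ^ 4))) \<longlonglongrightarrow> sqrt (sqrt 0)"
          by (intro tendsto_real_sqrt summable_LIMSEQ_zero elim)
        moreover have "sqrt (sqrt (?d n ^ 4)) = \<bar>?d n\<bar>" for n
        proof -
          have "?d n ^ 4 = ((?d n)\<^sup>2)\<^sup>2" by simp
          then show ?thesis by (simp only: real_sqrt_abs) simp
        qed
        ultimately have "(\<lambda>n. \<bar>?d n\<bar>) \<longlonglongrightarrow> 0" by simp
        then have "(\<lambda>n. ?d n) \<longlonglongrightarrow> 0" by (simp add: tendsto_rabs_zero_iff)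
        then have "(\<lambda>n. X (dyadic_floor (n + K) t) \<omega>) \<longlonglongrightarrow> X t \<omega>" by (simp add: LIM_zero_iff)
        then have "(\<lambda>n. X0 (dyadic_floor (n + K) t) \<omega>) \<longlonglongrightarrow> X t \<omega>" using K by (simp add: X0_def)
        then have "(\<lambda>n. X0 (dyadic_floor n t) \<omega>) \<longlonglongrightarrow> X t \<omega>" by (rule LIMSEQ_offset)
        then show ?case using elim by (simp add: Y_def limI)
      qed
    qed
  qed
qed

section \<open>Stationary processes and their mean square derivatives\<close>

lemma expectation_square_lincomb3:
  assumes L: "L4 f" "L4 g" "L4 h"
  shows "expectation (\<lambda>\<omega>. (a * f \<omega> + b * g \<omega> + c * h \<omega>)\<^sup>2) =
    a\<^sup>2 * expectation (\<lambda>\<omega>. f \<omega> * f \<omega>) + b\<^sup>2 * expectation (\<lambda>\<omega>. g \<omega> * g \<omega>)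
    + c\<^sup>2 * expectation (\<lambda>\<omega>. h \<omega> * h \<omega>) + 2 * a * b * expectation (\<lambda>\<omega>. f \<omega> * g \<omega>)
    + 2 * a * c * expectation (\<lambda>\<omega>. f \<omega> * h \<omega>) + 2 * b * c * expectation (\<lambda>\<omega>. g \<omega> * h \<omega>)"
proof -
  note [simp] = L4_integrable_mult[OF L(1,1)] L4_integrable_mult[OF L(2,2)] L4_integrable_mult[OF L(3,3)]
    L4_integrable_mult[OF L(1,2)] L4_integrable_mult[OF L(1,3)] L4_integrable_mult[OF L(2,3)]
  have "(a * f \<omega> + b * g \<omega> + c * h \<omega>)\<^sup>2 =
    a\<^sup>2 * (f \<omega> * f \<omega>) + b\<^sup>2 * (g \<omega> * g \<omega>) + c\<^sup>2 * (h \<omega> * h \<omega>) + 2 * a * b * (f \<omega> * g \<omega>)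
    + 2 * a * c * (f \<omega> * h \<omega>) + 2 * b * c * (g \<omega> * h \<omega>)" for \<omega>
    by (simp add: power2_eq_square algebra_simps)
  then show ?thesis by simp
qed

lemma expectation_diff_mult:
  assumes "L4 f" "L4 g" "L4 h"
  shows "expectation (\<lambda>\<omega>. (f \<omega> - g \<omega>) / c * h \<omega>) =
    (expectation (\<lambda>\<omega>. f \<omega> * h \<omega>) - expectation (\<lambda>\<omega>. g \<omega> * h \<omega>)) / c"
proof -
  have "(f \<omega> - g \<omega>) / c * h \<omega> = (f \<omega> * h \<omega> - g \<omega> * h \<omega>) / c" for \<omega> by (simp add: left_diff_distrib)
  then have "expectation (\<lambda>\<omega>. (f \<omega> - g \<omega>) / c * h \<omega>) = expectation (\<lambda>\<omega>. (f \<omega> * h \<omega> - g \<omega> * h \<omega>) / c)"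
    by presburger
  then show ?thesis using assms by (simp add: L4_integrable_mult)
qed

text \<open>Closure under combinations must be part of the notion, since the inequality is not
  stable under sums: for \<open>f\<close> standard normal and \<open>g\<close> equal to
  \<open>f\<close> times an independent random sign, both have kurtosis \<open>3\<close> but
  \<open>f + g\<close> has kurtosis \<open>6\<close>.\<close>

definition kurtosis_space :: "('a \<Rightarrow> real) set \<Rightarrow> bool" where
  "kurtosis_space V \<longleftrightarrow> (\<forall>f\<in>V. bounded_kurtosis f) \<and>
     (\<forall>f\<in>V. \<forall>g\<in>V. \<forall>a b. (\<lambda>\<omega>. a * f \<omega> + b * g \<omega>) \<in> V)"

text \<open>The space \<open>V\<close> is a parameter because passing to the derivative replaces it
  by the space of its dominated limits.\<close>

definition stationary_process ::
  "real set \<Rightarrow> (real \<Rightarrow> real) \<Rightarrow> ('a \<Rightarrow> real) set \<Rightarrow> (real \<Rightarrow> 'a \<Rightarrow> real) \<Rightarrow> bool" where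
  "stationary_process I k V X \<longleftrightarrow> kurtosis_space V \<and> (\<forall>z\<in>I. X z \<in> V) \<and>
     (\<forall>s\<in>I. \<forall>t\<in>I. expectation (\<lambda>\<omega>. X s \<omega> * X t \<omega>) = k (s - t))"

lemma kurtosis_spaceD:
  assumes "kurtosis_space V" "f \<in> V"
  shows "L4 f" "expectation (\<lambda>\<omega>. f \<omega> ^ 4) \<le> 3 * (expectation (\<lambda>\<omega>. f \<omega> ^ 2))\<^sup>2"
  using assms by (auto simp: kurtosis_space_def bounded_kurtosis_def)

lemma kurtosis_space_lincomb:
  assumes "kurtosis_space V" "f \<in> V" "g \<in> V"
  shows "(\<lambda>\<omega>. a * f \<omega> + b * g \<omega>) \<in> V"
  using assms by (auto simp: kurtosis_space_def)

lemma kurtosis_space_diff: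
  assumes "kurtosis_space V" "f \<in> V" "g \<in> V"
  shows "(\<lambda>\<omega>. f \<omega> - g \<omega>) \<in> V"
  using kurtosis_space_lincomb[OF assms, of 1 "-1"] by simp

text \<open>Near the diagonal this is the Lipschitz bound at \<open>0\<close>. For
  \<open>|s - t| \<ge> \<delta>\<close> the second moment is at most \<open>4 * k 0\<close>, which
  the term \<open>4 * k 0 / \<delta> * |s - t|\<close> covers, so one constant works on all of
  \<open>I\<close>.\<close>

lemma stationary_increment_bound:
  assumes X: "stationary_process I k V X" and lip: "lipschitz_at_zero k"
  obtains C where "\<And>s t. s \<in> I \<Longrightarrow> t \<in> I \<Longrightarrow> expectation (\<lambda>\<omega>. (X s \<omega> - X t \<omega>)\<^sup>2) \<le> C * \<bar>s - t\<bar>"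
proof -
  have V: "kurtosis_space V" and XV: "\<And>z. z \<in> I \<Longrightarrow> X z \<in> V"
    and cov: "\<And>s t. s \<in> I \<Longrightarrow> t \<in> I \<Longrightarrow> expectation (\<lambda>\<omega>. X s \<omega> * X t \<omega>) = k (s - t)"
    using X by (auto simp: stationary_process_def)
  have L: "L4 (X z)" if "z \<in> I" for z by (rule kurtosis_spaceD[OF V XV[OF that]])
  obtain C \<delta> where \<delta>: "\<delta> > 0" and C: "\<And>h. \<bar>h\<bar> < \<delta> \<Longrightarrow> \<bar>k h - k 0\<bar> \<le> C * \<bar>h\<bar>"
    using lip by (auto simp: lipschitz_at_zero_def)
  show thesis
  proof
    fix s t assume st: "s \<in> I" "t \<in> I"
    have sq: "expectation (\<lambda>\<omega>. (X s \<omega> + b * X t \<omega>)\<^sup>2) = k 0 + b\<^sup>2 * k 0 + 2 * b * k (s - t)" for b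
      using expectation_square_lincomb3[OF L[OF st(1)] L[OF st(2)] L[OF st(1)], of 1 b 0] st by (simp add: cov)
    have sym: "k (t - s) = k (s - t)" using cov[OF st] cov[OF st(2,1)] by (simp add: mult.commute)
    have "expectation (\<lambda>\<omega>. (X s \<omega> - X t \<omega>)\<^sup>2) = 2 * (k 0 - k (s - t))"
      using sq[of "-1"] by simp
    also have "\<dots> \<le> (2 * \<bar>C\<bar> + 4 * k 0 / \<delta>) * \<bar>s - t\<bar>"
    proof (cases "\<bar>s - t\<bar> < \<delta>")
      case True
      have "0 \<le> expectation (\<lambda>\<omega>. X s \<omega> * X s \<omega>)" by simp
      then have "0 \<le> k 0" using cov[OF st(1,1)] by simp
      then have "0 \<le> 4 * k 0 / \<delta> * \<bar>s - t\<bar>" using \<delta> by simp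
      moreover have "C * \<bar>s - t\<bar> \<le> \<bar>C\<bar> * \<bar>s - t\<bar>" by (intro mult_right_mono) auto
      ultimately show ?thesis using C[OF True] by (simp add: algebra_simps)
    next
      case False
      \<comment> \<open>The square of the sum, rather than of the difference, bounds
        \<open>k (s - t)\<close> from below by \<open>- k 0\<close>.\<close>
      have "0 \<le> expectation (\<lambda>\<omega>. (X s \<omega> + 1 * X t \<omega>)\<^sup>2)" by simp
      then have 1: "- k (s - t) \<le> k 0" unfolding sq by simp
      have "0 \<le> expectation (\<lambda>\<omega>. X s \<omega> * X s \<omega>)" by simp
      then have "0 \<le> k 0" using cov[OF st(1,1)] by simp
      then have "4 * k 0 / \<delta> * \<delta> \<le> 4 * k 0 / \<delta> * \<bar>s - t\<bar>"
        using False \<delta> by (intro mult_left_mono) auto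
      then have "4 * k 0 \<le> 4 * k 0 / \<delta> * \<bar>s - t\<bar>" using \<delta> by simp
      moreover have "0 \<le> 2 * \<bar>C\<bar> * \<bar>s - t\<bar>" by simp
      ultimately have "4 * k 0 \<le> (2 * \<bar>C\<bar> + 4 * k 0 / \<delta>) * \<bar>s - t\<bar>" unfolding distrib_right by linarith
      moreover have "2 * (k 0 - k (s - t)) \<le> 4 * k 0" using 1 by simp
      ultimately show ?thesis by (rule order_trans[rotated])
    qed
    finally show "expectation (\<lambda>\<omega>. (X s \<omega> - X t \<omega>)\<^sup>2) \<le> (2 * \<bar>C\<bar> + 4 * k 0 / \<delta>) * \<bar>s - t\<bar>" .
  qed
qed

lemma stationary_continuous_modification:
  assumes X: "stationary_process I k V X" and "open I" and lip: "lipschitz_at_zero k"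
  obtains Y where "\<And>z. z \<in> I \<Longrightarrow> Y z \<in> borel_measurable M"
    "\<And>z. z \<in> I \<Longrightarrow> AE \<omega> in M. Y z \<omega> = X z \<omega>"
    "\<And>\<omega>. continuous_on I (\<lambda>z. Y z \<omega>)"
proof -
  have V: "kurtosis_space V" and XV: "\<And>z. z \<in> I \<Longrightarrow> X z \<in> V"
    using X by (auto simp: stationary_process_def)
  obtain C where C: "\<And>s t. s \<in> I \<Longrightarrow> t \<in> I \<Longrightarrow> expectation (\<lambda>\<omega>. (X s \<omega> - X t \<omega>)\<^sup>2) \<le> C * \<bar>s - t\<bar>"
    using stationary_increment_bound[OF X lip] by blast
  have diff: "(\<lambda>\<omega>. X s \<omega> - X t \<omega>) \<in> V" if "s \<in> I" "t \<in> I" for s t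
    by (intro kurtosis_space_diff V XV that)
  show thesis
  proof (rule continuous_modification[OF \<open>open I\<close>])
    show "X z \<in> borel_measurable M" if "z \<in> I" for z
      using kurtosis_spaceD(1)[OF V XV[OF that]] by (simp add: L4_def)
    show "L4 (\<lambda>\<omega>. X s \<omega> - X t \<omega>)" if "s \<in> I" "t \<in> I" for s t
      by (rule kurtosis_spaceD(1)[OF V diff[OF that]])
    show "expectation (\<lambda>\<omega>. (X s \<omega> - X t \<omega>) ^ 4) \<le> (3 * C\<^sup>2) * (s - t)\<^sup>2" if st: "s \<in> I" "t \<in> I" for s t
    proof -
      have "expectation (\<lambda>\<omega>. (X s \<omega> - X t \<omega>) ^ 4) \<le> 3 * (expectation (\<lambda>\<omega>. (X s \<omega> - X t \<omega>)\<^sup>2))\<^sup>2"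
        by (rule kurtosis_spaceD(2)[OF V diff[OF st]])
      also have "\<dots> \<le> 3 * (C * \<bar>s - t\<bar>)\<^sup>2"
        by (intro mult_left_mono power_mono C st) auto
      finally show ?thesis by (simp add: power_mult_distrib)
    qed
  qed (use that in blast)
qed

lemma kurtosis_space_dominated_limits:
  assumes V: "kurtosis_space V"
  shows "kurtosis_space {g. \<exists>f. (\<forall>n. f n \<in> V) \<and> dominated_limit f g}"
  unfolding kurtosis_space_def
proof (intro conjI ballI allI)
  fix g assume "g \<in> {g. \<exists>f. (\<forall>n. f n \<in> V) \<and> dominated_limit f g}"
  then show "bounded_kurtosis g"
    using V by (auto intro: bounded_kurtosis_limit simp: kurtosis_space_def)
next
  fix g g' and a b :: real
  assume "g \<in> {g. \<exists>f. (\<forall>n. f n \<in> V) \<and> dominated_limit f g}"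
    "g' \<in> {g. \<exists>f. (\<forall>n. f n \<in> V) \<and> dominated_limit f g}"
  then obtain f f' where "\<And>n. f n \<in> V" "dominated_limit f g" "\<And>n. f' n \<in> V" "dominated_limit f' g'"
    by blast
  then show "(\<lambda>\<omega>. a * g \<omega> + b * g' \<omega>) \<in> {g. \<exists>f. (\<forall>n. f n \<in> V) \<and> dominated_limit f g}"
    using V by (auto intro!: exI[of _ "\<lambda>n \<omega>. a * f n \<omega> + b * f' n \<omega>"] dominated_limit_lincomb kurtosis_space_lincomb)
qed

text \<open>Halving the step from \<open>2 d\<close> to \<open>d\<close> changes the quotient by a
  second difference divided by \<open>2 d\<close>. In its variance the terms \<open>(2 d)^2\<close>
  and \<open>4 d^2\<close> in front of \<open>k\<^sub>2 0\<close> cancel, leaving order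
  \<open>d^3\<close>. The change thus has second moment of order \<open>d\<close> and, by the
  kurtosis inequality, fourth moment of order \<open>d^2\<close>, that is,
  \<open>4^(-n)\<close>.\<close>

lemma difference_quotients_dominated:
  assumes X: "stationary_process I k V X"
    and k: "\<And>x. (k has_real_derivative k\<^sub>1 x) (at x)" "\<And>x. (k\<^sub>1 has_real_derivative k\<^sub>2 x) (at x)"
    and C: "\<And>h. \<bar>h\<bar> < \<delta> \<Longrightarrow> \<bar>k h + k (- h) - 2 * k 0 - h\<^sup>2 * k\<^sub>2 0\<bar> \<le> C * \<bar>h\<bar> ^ 3"
    and c: "0 < c" "c < \<delta>" and I: "\<And>h. 0 \<le> h \<Longrightarrow> h \<le> c \<Longrightarrow> t + h \<in> I"
  defines "h \<equiv> \<lambda>n. c * (1 / 2) ^ n"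
  obtains W where "L4 W" "\<And>n. AE \<omega> in M. \<bar>(X (t + h n) \<omega> - X t \<omega>) / h n\<bar> \<le> W \<omega>"
    "AE \<omega> in M. convergent (\<lambda>n. (X (t + h n) \<omega> - X t \<omega>) / h n)"
proof -
  have V: "kurtosis_space V" and XV: "\<And>z. z \<in> I \<Longrightarrow> X z \<in> V"
    and cov: "\<And>s t. s \<in> I \<Longrightarrow> t \<in> I \<Longrightarrow> expectation (\<lambda>\<omega>. X s \<omega> * X t \<omega>) = k (s - t)"
    using X by (auto simp: stationary_process_def)
  have L: "L4 (X z)" if "z \<in> I" for z by (rule kurtosis_spaceD[OF V XV[OF that]])
  have h: "0 < h n" "h n \<le> c" for n using c by (auto simp: h_def intro!: mult_left_le power_le_one)
  have tI: "t \<in> I" "t + h n \<in> I" for n using I[of 0] I[of "h n"] h[of n] c by auto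
  show thesis
  \<comment> \<open>The factor \<open>7\<close> rounds up \<open>27/4\<close>, which arises from
    \<open>3 * (3 * C * d)^2\<close> with \<open>d = c / 2^(n + 1)\<close>.\<close>
  proof (rule L4_fast_convergent[of "\<lambda>n \<omega>. (X (t + h n) \<omega> - X t \<omega>) / h n" "7 * C\<^sup>2 * c\<^sup>2"])
    fix n
    show "L4 (\<lambda>\<omega>. (X (t + h n) \<omega> - X t \<omega>) / h n)"
      using L4_cmult[OF L4_diff[OF L[OF tI(2)] L[OF tI(1)]], of "1 / h n" n] by simp
    define d where "d = h (Suc n)"
    have d: "h n = 2 * d" by (simp add: d_def h_def)
    have d0: "0 < d" using h(1)[of "Suc n"] by (simp add: d_def)
    have small: "2 * d \<le> c" using h(2)[of n] d by simp
    have I2: "t + 2 * d \<in> I" "t + d \<in> I" using d0 small by (auto intro!: I)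
    define Z where "Z \<omega> = 1 * X (t + 2 * d) \<omega> + (- 2) * X (t + d) \<omega> + 1 * X t \<omega>" for \<omega>
    have EZ: "expectation (\<lambda>\<omega>. (Z \<omega>)\<^sup>2) \<le> 12 * C * d ^ 3"
    proof -
      have "k (- d) = k d" "k (- (2 * d)) = k (2 * d)"
        using cov[OF I2(2) tI(1)] cov[OF tI(1) I2(2)] cov[OF I2(1) tI(1)] cov[OF tI(1) I2(1)]
        by (simp_all add: mult.commute)
      then have "expectation (\<lambda>\<omega>. (Z \<omega>)\<^sup>2) =
        (k (2 * d) + k (- (2 * d)) - 2 * k 0 - (2 * d)\<^sup>2 * k\<^sub>2 0) - 4 * (k d + k (- d) - 2 * k 0 - d\<^sup>2 * k\<^sub>2 0)"
        unfolding Z_def expectation_square_lincomb3[OF L[OF I2(1)] L[OF I2(2)] L[OF tI(1)]]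
        by (simp only: cov I2 tI(1)) (simp add: algebra_simps power2_eq_square)
      also have "\<dots> \<le> C * (2 * d) ^ 3 + 4 * (C * d ^ 3)"
        using C[of "2 * d"] C[of d] d0 small c unfolding abs_le_iff by simp
      finally show ?thesis by (simp add: power_mult_distrib)
    qed
    define Q where "Q \<omega> = (X (t + h (Suc n)) \<omega> - X t \<omega>) / h (Suc n) - (X (t + h n) \<omega> - X t \<omega>) / h n" for \<omega>
    have Q: "Q \<omega> = - (Z \<omega> / (2 * d))" for \<omega>
      unfolding Q_def Z_def d d_def[symmetric] using d0 by (simp add: field_simps)
    have "Q \<in> V"
    proof -
      have "(\<lambda>\<omega>. (- (1 / h (Suc n) - 1 / h n)) * X t \<omega> + 1 * ((1 / h (Suc n)) * X (t + h (Suc n)) \<omega> + (- 1 / h n) * X (t + h n) \<omega>)) \<in> V"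
        by (intro kurtosis_space_lincomb V XV tI)
      also have "(\<lambda>\<omega>. (- (1 / h (Suc n) - 1 / h n)) * X t \<omega> + 1 * ((1 / h (Suc n)) * X (t + h (Suc n)) \<omega> + (- 1 / h n) * X (t + h n) \<omega>)) = Q"
        using h(1)[of n] h(1)[of "Suc n"] by (simp add: Q_def fun_eq_iff field_simps)
      finally show ?thesis .
    qed
    have EQ: "expectation (\<lambda>\<omega>. (Q \<omega>)\<^sup>2) \<le> 3 * C * d"
    proof -
      have "expectation (\<lambda>\<omega>. (Q \<omega>)\<^sup>2) = expectation (\<lambda>\<omega>. (Z \<omega>)\<^sup>2) / (2 * d)\<^sup>2"
        unfolding Q by (simp add: power_divide)
      also have "\<dots> \<le> 12 * C * d ^ 3 / (2 * d)\<^sup>2" by (intro divide_right_mono EZ) simp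
      also have "\<dots> = 3 * C * d" using d0 by (simp add: power2_eq_square power3_eq_cube)
      finally show ?thesis .
    qed
    have "expectation (\<lambda>\<omega>. Q \<omega> ^ 4) \<le> 3 * (expectation (\<lambda>\<omega>. Q \<omega> ^ 2))\<^sup>2"
      by (rule kurtosis_spaceD(2)[OF V \<open>Q \<in> V\<close>])
    also have "\<dots> \<le> 3 * (3 * C * d)\<^sup>2" by (intro mult_left_mono power_mono EQ) auto
    also have "\<dots> = 27 / 4 * (C\<^sup>2 * c\<^sup>2 * (1 / 4) ^ n)"
    proof -
      have "d\<^sup>2 = c\<^sup>2 * ((1 / 2) ^ n * (1 / 2) ^ n) / 4"
        by (simp add: d_def h_def power2_eq_square)
      also have "(1 / 2 :: real) ^ n * (1 / 2) ^ n = (1 / 4) ^ n" by (simp flip: power_mult_distrib)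
      finally show ?thesis by (simp add: power_mult_distrib)
    qed
    also have "\<dots> \<le> 7 * (C\<^sup>2 * c\<^sup>2 * (1 / 4) ^ n)" by (intro mult_right_mono) auto
    finally show "expectation (\<lambda>\<omega>. ((X (t + h (Suc n)) \<omega> - X t \<omega>) / h (Suc n) - (X (t + h n) \<omega> - X t \<omega>) / h n) ^ 4)
      \<le> 7 * C\<^sup>2 * c\<^sup>2 * (1 / 4) ^ n"
      by (simp add: Q_def mult.assoc)
  qed (use that in blast)
qed

text \<open>Covariances are differentiated in one argument at a time: difference quotients of
  \<open>X\<close> against \<open>X\<close> give \<open>k\<^sub>1\<close>, and against
  \<open>X'\<close> give \<open>- k\<^sub>2\<close>. Although \<open>X'\<close> is built from
  forward quotients only, the final estimate holds for \<open>h\<close> of either sign, as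
  integration to the left of the base point requires.\<close>

lemma mean_square_derivative:
  assumes X: "stationary_process I k V X" and "open I"
    and k: "\<And>x. (k has_real_derivative k\<^sub>1 x) (at x)" "\<And>x. (k\<^sub>1 has_real_derivative k\<^sub>2 x) (at x)"
    and lip: "lipschitz_at_zero k\<^sub>2"
  obtains V' X' C \<delta> where "stationary_process I (\<lambda>x. - k\<^sub>2 x) V' X'" "\<delta> > 0"
    "\<And>t h. t \<in> I \<Longrightarrow> t + h \<in> I \<Longrightarrow> \<bar>h\<bar> < \<delta> \<Longrightarrow>
      expectation (\<lambda>\<omega>. (X (t + h) \<omega> - X t \<omega> - h * X' t \<omega>)\<^sup>2) \<le> C * \<bar>h\<bar> ^ 3"
proof -
  have V: "kurtosis_space V" and XV: "\<And>z. z \<in> I \<Longrightarrow> X z \<in> V"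
    and cov: "\<And>s t. s \<in> I \<Longrightarrow> t \<in> I \<Longrightarrow> expectation (\<lambda>\<omega>. X s \<omega> * X t \<omega>) = k (s - t)"
    using X by (auto simp: stationary_process_def)
  have L: "L4 (X z)" if "z \<in> I" for z by (rule kurtosis_spaceD[OF V XV[OF that]])
  obtain C \<delta> where C: "0 \<le> C" "0 < \<delta>"
    "\<And>h. \<bar>h\<bar> < \<delta> \<Longrightarrow> \<bar>k\<^sub>1 h - k\<^sub>1 0 - h * k\<^sub>2 0\<bar> \<le> C * h\<^sup>2"
    "\<And>h. \<bar>h\<bar> < \<delta> \<Longrightarrow> \<bar>k h + k (- h) - 2 * k 0 - h\<^sup>2 * k\<^sub>2 0\<bar> \<le> C * \<bar>h\<bar> ^ 3"
    using second_order_expansion[OF k lip] by blast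
  \<comment> \<open>As \<open>I\<close> is merely open, the initial step depends on
    \<open>t\<close>; keeping it below \<open>\<delta>\<close> makes the expansion of
    \<open>k\<close> applicable.\<close>
  have "\<forall>t\<in>I. \<exists>c. 0 < c \<and> c < \<delta> \<and> (\<forall>h. 0 \<le> h \<longrightarrow> h \<le> c \<longrightarrow> t + h \<in> I)"
  proof
    fix t assume "t \<in> I"
    then obtain \<epsilon> where \<epsilon>: "\<epsilon> > 0" "cball t \<epsilon> \<subseteq> I" using \<open>open I\<close> by (meson open_contains_cball)
    then show "\<exists>c. 0 < c \<and> c < \<delta> \<and> (\<forall>h. 0 \<le> h \<longrightarrow> h \<le> c \<longrightarrow> t + h \<in> I)"
      using \<open>0 < \<delta>\<close> by (intro exI[of _ "min \<epsilon> (\<delta> / 2)"]) (auto simp: subset_eq dist_real_def)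
  qed
  then obtain c where c: "\<And>t. t \<in> I \<Longrightarrow> 0 < c t" "\<And>t. t \<in> I \<Longrightarrow> c t < \<delta>"
    "\<And>t h. t \<in> I \<Longrightarrow> 0 \<le> h \<Longrightarrow> h \<le> c t \<Longrightarrow> t + h \<in> I"
    by metis
  define h where "h t n = c t * (1 / 2) ^ n" for t n
  define D where "D t n \<omega> = (X (t + h t n) \<omega> - X t \<omega>) / h t n" for t n \<omega>
  define X' where "X' t \<omega> = lim (\<lambda>n. D t n \<omega>)" for t \<omega>
  have h: "0 < h t n" "h t n \<le> c t" if "t \<in> I" for t n
    using c(1)[OF that] by (auto simp: h_def intro!: mult_left_le power_le_one)
  have hI: "t + h t n \<in> I" if "t \<in> I" for t n using h[OF that, of n] c(3)[OF that] by simp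
  have h0: "h t \<longlonglongrightarrow> 0" for t
    unfolding h_def by (rule tendsto_eq_intros LIMSEQ_power_zero refl)+ auto
  have DV: "D t n \<in> V" if "t \<in> I" for t n
    using kurtosis_space_lincomb[OF V XV[OF hI[OF that]] XV[OF that], of "1 / h t n" n "- (1 / h t n)"]
    by (simp add: D_def[abs_def] diff_divide_distrib)
  have lim: "dominated_limit (D t) (X' t)" if t: "t \<in> I" for t
  proof -
    obtain W where W: "L4 W" "\<And>n. AE \<omega> in M. \<bar>D t n \<omega>\<bar> \<le> W \<omega>" "AE \<omega> in M. convergent (\<lambda>n. D t n \<omega>)"
      using difference_quotients_dominated[OF X k C(4) c(1)[OF t] c(2)[OF t] c(3)[OF t]]
      unfolding D_def h_def by blast
    have LD: "L4 (D t n)" for n by (rule kurtosis_spaceD(1)[OF V DV[OF t]])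
    have "AE \<omega> in M. (\<lambda>n. D t n \<omega>) \<longlonglongrightarrow> X' t \<omega>"
      using W(3) unfolding X'_def by eventually_elim (simp add: convergent_LIMSEQ_iff)
    moreover have "X' t \<in> borel_measurable M"
      unfolding X'_def by (rule borel_measurable_lim_metric) (use LD in \<open>auto simp: L4_def\<close>)
    ultimately show ?thesis using W LD unfolding dominated_limit_def by blast
  qed
  have L': "L4 (X' t)" if "t \<in> I" for t by (rule dominated_limit_L4[OF lim[OF that]])
  have cross: "expectation (\<lambda>\<omega>. X' t \<omega> * X u \<omega>) = k\<^sub>1 (t - u)" if t: "t \<in> I" and u: "u \<in> I" for t u
  proof (rule LIMSEQ_unique[OF dominated_limit_mult[OF lim[OF t] L[OF u]]])
    have "expectation (\<lambda>\<omega>. D t n \<omega> * X u \<omega>) = (k ((t - u) + h t n) - k (t - u)) / h t n" for n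
      unfolding D_def expectation_diff_mult[OF L[OF hI[OF t]] L[OF t] L[OF u]]
      by (simp only: cov hI t u) (simp add: algebra_simps)
    moreover have "(\<lambda>n. (k ((t - u) + h t n) - k (t - u)) / h t n) \<longlonglongrightarrow> k\<^sub>1 (t - u)"
      using h(1)[OF t] by (intro DERIV_seq[OF k(1) h0]) (simp add: less_imp_neq[symmetric])
    ultimately show "(\<lambda>n. expectation (\<lambda>\<omega>. D t n \<omega> * X u \<omega>)) \<longlonglongrightarrow> k\<^sub>1 (t - u)" by simp
  qed
  have cov': "expectation (\<lambda>\<omega>. X' t \<omega> * X' s \<omega>) = - k\<^sub>2 (s - t)" if t: "t \<in> I" and s: "s \<in> I" for t s
  proof (rule LIMSEQ_unique[OF dominated_limit_mult[OF lim[OF t] L'[OF s]]])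
    \<comment> \<open>Here \<open>t\<close> enters \<open>k\<^sub>1 (s - t)\<close> with a minus
      sign, so a forward step in \<open>t\<close> is a backward step of the argument; this is where
      the sign of \<open>- k\<^sub>2\<close> originates.\<close>
    have "expectation (\<lambda>\<omega>. D t n \<omega> * X' s \<omega>) = - ((k\<^sub>1 ((s - t) + - h t n) - k\<^sub>1 (s - t)) / (- h t n))" for n
      unfolding D_def expectation_diff_mult[OF L[OF hI[OF t]] L[OF t] L'[OF s]]
      using cross[OF s hI[OF t]] cross[OF s t] by (simp add: mult.commute algebra_simps)
    moreover have "(\<lambda>n. - ((k\<^sub>1 ((s - t) + - h t n) - k\<^sub>1 (s - t)) / (- h t n))) \<longlonglongrightarrow> - k\<^sub>2 (s - t)"
      using h(1)[OF t] tendsto_minus[OF h0[of t]]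
      by (intro tendsto_minus DERIV_seq[OF k(2), of "\<lambda>n. - h t n"]) (auto simp: less_imp_neq[symmetric])
    ultimately show "(\<lambda>n. expectation (\<lambda>\<omega>. D t n \<omega> * X' s \<omega>)) \<longlonglongrightarrow> - k\<^sub>2 (s - t)" by simp
  qed
  show thesis
  proof
    show "stationary_process I (\<lambda>x. - k\<^sub>2 x) {g. \<exists>f. (\<forall>n. f n \<in> V) \<and> dominated_limit f g} X'"
      unfolding stationary_process_def
    proof (intro conjI ballI kurtosis_space_dominated_limits[OF V])
      show "X' z \<in> {g. \<exists>f. (\<forall>n. f n \<in> V) \<and> dominated_limit f g}" if "z \<in> I" for z
        using lim[OF that] DV[OF that] by blast
      show "expectation (\<lambda>\<omega>. X' s \<omega> * X' t \<omega>) = - k\<^sub>2 (s - t)" if "s \<in> I" "t \<in> I" for s t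
        using cov'[OF that(2,1)] by (simp add: mult.commute)
    qed
    show "\<delta> > 0" by fact
    fix t d assume t: "t \<in> I" and td: "t + d \<in> I" and d: "\<bar>d\<bar> < \<delta>"
    have "k (- d) = k d"
      using cov[OF t td] cov[OF td t] by (simp add: mult.commute)
    \<comment> \<open>The square is regrouped into the two remainders of the expansion. The
      contributions of \<open>k\<^sub>2 0\<close> combine to \<open>- d^2\<close>, the coefficient
      coming from the variance of \<open>X' t\<close>.\<close>
    then have "expectation (\<lambda>\<omega>. (1 * X (t + d) \<omega> + (- 1) * X t \<omega> + (- d) * X' t \<omega>)\<^sup>2) =
       - (k d + k (- d) - 2 * k 0 - d\<^sup>2 * k\<^sub>2 0) + (- 2 * d) * (k\<^sub>1 (- d) - k\<^sub>1 0 - (- d) * k\<^sub>2 0)"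
      unfolding expectation_square_lincomb3[OF L[OF td] L[OF t] L'[OF t]]
      using cross[OF t td] cross[OF t t]
      by (simp only: cov cov' t td mult.commute[of "X _ _" "X' _ _"]) (simp add: algebra_simps power2_eq_square)
    also have "\<dots> \<le> C * \<bar>d\<bar> ^ 3 + \<bar>- 2 * d\<bar> * (C * (- d)\<^sup>2)"
    proof (rule add_mono)
      show "- (k d + k (- d) - 2 * k 0 - d\<^sup>2 * k\<^sub>2 0) \<le> C * \<bar>d\<bar> ^ 3" using C(4)[OF d] by linarith
      have "(- 2 * d) * (k\<^sub>1 (- d) - k\<^sub>1 0 - (- d) * k\<^sub>2 0) \<le> \<bar>- 2 * d\<bar> * \<bar>k\<^sub>1 (- d) - k\<^sub>1 0 - (- d) * k\<^sub>2 0\<bar>"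
        by (simp only: abs_mult[symmetric] abs_ge_self)
      also have "\<dots> \<le> \<bar>- 2 * d\<bar> * (C * (- d)\<^sup>2)" using d by (intro mult_left_mono C(3)) auto
      finally show "(- 2 * d) * (k\<^sub>1 (- d) - k\<^sub>1 0 - (- d) * k\<^sub>2 0) \<le> \<bar>- 2 * d\<bar> * (C * (- d)\<^sup>2)" .
    qed
    also have "\<bar>- 2 * d\<bar> * (C * (- d)\<^sup>2) = 2 * C * \<bar>d\<bar> ^ 3"
    proof -
      have "\<bar>- 2 * d\<bar> = 2 * \<bar>d\<bar>" by (simp only: abs_mult)
      moreover have "(- d)\<^sup>2 = \<bar>d\<bar>\<^sup>2" by simp
      ultimately show ?thesis by (simp only: power3_eq_cube power2_eq_square mult_ac)
    qed
    also have "C * \<bar>d\<bar> ^ 3 + 2 * C * \<bar>d\<bar> ^ 3 = (3 * C) * \<bar>d\<bar> ^ 3" by simp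
    finally show "expectation (\<lambda>\<omega>. (X (t + d) \<omega> - X t \<omega> - d * X' t \<omega>)\<^sup>2) \<le> (3 * C) * \<bar>d\<bar> ^ 3"
      by simp
  qed
qed

lemma L4_sum:
  assumes "finite J" "\<And>j. j \<in> J \<Longrightarrow> L4 (f j)"
  shows "L4 (\<lambda>\<omega>. \<Sum>j\<in>J. f j \<omega>)"
  using assms by (induction rule: finite_induct) (auto intro: L4_add simp: L4_def[of "\<lambda>_. 0"])

section \<open>Integration of the derivative process\<close>

text \<open>The errors of \<open>2^m\<close> linear approximations telescope to
  \<open>X z - X a\<close> minus a Riemann sum. Each has second moment of order
  \<open>2^(- 3 m)\<close>; by Cauchy-Schwarz their sum has second moment of order
  \<open>2^m * 2^m * 2^(- 3 m) = 2^(- m)\<close>. This is summable, so the total error vanishes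
  almost surely.\<close>

lemma mean_square_antiderivative:
  assumes I: "is_interval I" "open I" and az: "a \<in> I" "z \<in> I"
    and L: "\<And>z. z \<in> I \<Longrightarrow> L4 (X z)" "\<And>z. z \<in> I \<Longrightarrow> L4 (X' z)"
    and bound: "\<And>t h. t \<in> I \<Longrightarrow> t + h \<in> I \<Longrightarrow> \<bar>h\<bar> < \<delta> \<Longrightarrow>
      expectation (\<lambda>\<omega>. (X (t + h) \<omega> - X t \<omega> - h * X' t \<omega>)\<^sup>2) \<le> C * \<bar>h\<bar> ^ 3" and "\<delta> > 0"
    and Y': "\<And>z. z \<in> I \<Longrightarrow> AE \<omega> in M. Y' z \<omega> = X' z \<omega>" "\<And>\<omega>. continuous_on I (\<lambda>z. Y' z \<omega>)"
  shows "AE \<omega> in M. X z \<omega> - X a \<omega> = (LBINT y=a..z. Y' y \<omega>)"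
proof -
  define \<tau> where "\<tau> m i = a + real i / real (2 ^ m) * (z - a)" for m i :: nat
  define h where "h m = (z - a) / 2 ^ m" for m :: nat
  have \<tau>I: "\<tau> m i \<in> I" if "i \<le> 2 ^ m" for m i
  proof -
    have "real i \<le> real (2 ^ m)" using that by (simp only: of_nat_le_iff)
    then show ?thesis unfolding \<tau>_def by (intro is_interval_affine_mem[OF I(1) az]) auto
  qed
  have \<tau>_Suc: "\<tau> m (Suc i) = \<tau> m i + h m" for m i
    by (simp add: \<tau>_def h_def add_divide_distrib algebra_simps)
  \<comment> \<open>The summand \<open>1\<close> keeps the denominator positive when
    \<open>z = a\<close>.\<close>
  have "0 < \<delta> / (\<bar>z - a\<bar> + 1)" using \<open>\<delta> > 0\<close> by (intro divide_pos_pos) auto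
  from real_arch_pow_inv[OF this, of "1 / 2"]
  obtain N where N: "(1 / 2 :: real) ^ N < \<delta> / (\<bar>z - a\<bar> + 1)" by auto
  have small: "\<bar>h m\<bar> < \<delta>" if "N \<le> m" for m
  proof -
    have "(1 / 2 :: real) ^ m < \<delta> / (\<bar>z - a\<bar> + 1)"
      by (rule le_less_trans[OF power_decreasing[OF that] N]) auto
    then have "(\<bar>z - a\<bar> + 1) * (1 / 2) ^ m < \<delta>" by (simp add: pos_less_divide_eq mult.commute)
    moreover have "\<bar>h m\<bar> \<le> (\<bar>z - a\<bar> + 1) * (1 / 2) ^ m"
      by (simp add: h_def abs_divide power_divide divide_right_mono)
    ultimately show ?thesis by linarith
  qed
  define e where "e m i \<omega> = X (\<tau> m i + h m) \<omega> - X (\<tau> m i) \<omega> - h m * X' (\<tau> m i) \<omega>" for m i \<omega>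
  define S where "S m \<omega> = (\<Sum>i<2 ^ m. e m i \<omega>)" for m \<omega>
  have Le: "L4 (e m i)" if "i < 2 ^ m" for m i
    unfolding e_def \<tau>_Suc[symmetric]
    by (intro L4_diff L4_cmult L \<tau>I) (use that in auto)
  have LS: "L4 (S m)" for m unfolding S_def by (intro L4_sum Le) auto
  have ES: "expectation (\<lambda>\<omega>. (S m \<omega>)\<^sup>2) \<le> (C * \<bar>z - a\<bar> ^ 3) * (1 / 2) ^ m" if m: "N \<le> m" for m
  proof -
    have "expectation (\<lambda>\<omega>. (S m \<omega>)\<^sup>2) \<le> expectation (\<lambda>\<omega>. (\<Sum>i<2 ^ m. (e m i \<omega>)\<^sup>2) * 2 ^ m)"
    proof (rule integral_mono)
      show "integrable M (\<lambda>\<omega>. (S m \<omega>)\<^sup>2)" by (rule L4_integrable_power2[OF LS])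
      show "integrable M (\<lambda>\<omega>. (\<Sum>i<2 ^ m. (e m i \<omega>)\<^sup>2) * 2 ^ m)"
        by (intro integrable_mult_left Bochner_Integration.integrable_sum L4_integrable_power2 Le) simp
      show "(S m \<omega>)\<^sup>2 \<le> (\<Sum>i<2 ^ m. (e m i \<omega>)\<^sup>2) * 2 ^ m" for \<omega>
        unfolding S_def using sum_squared_le_sum_of_squares[of "\<lambda>i. e m i \<omega>" "{..<2 ^ m}"] by simp
    qed
    also have "\<dots> = (\<Sum>i<2 ^ m. expectation (\<lambda>\<omega>. (e m i \<omega>)\<^sup>2)) * 2 ^ m"
      by (simp add: Bochner_Integration.integral_sum L4_integrable_power2 Le)
    also have "\<dots> \<le> (\<Sum>i\<in>{..<2 ^ m :: nat}. C * \<bar>h m\<bar> ^ 3) * 2 ^ m"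
    proof (intro mult_right_mono sum_mono)
      fix i :: nat assume "i \<in> {..<2 ^ m}"
      then have "\<tau> m i \<in> I" "\<tau> m i + h m \<in> I" by (auto simp: \<tau>_Suc[symmetric] intro!: \<tau>I)
      then show "expectation (\<lambda>\<omega>. (e m i \<omega>)\<^sup>2) \<le> C * \<bar>h m\<bar> ^ 3"
        unfolding e_def by (intro bound small m)
    qed simp
    also have "\<dots> = (C * \<bar>z - a\<bar> ^ 3) * (1 / 2) ^ m"
    proof -
      have "\<bar>h m\<bar> = \<bar>z - a\<bar> * (1 / 2) ^ m" by (simp add: h_def abs_divide power_one_over)
      then have "(\<Sum>i\<in>{..<2 ^ m :: nat}. C * \<bar>h m\<bar> ^ 3) * 2 ^ m = 2 ^ m * (C * (\<bar>z - a\<bar> * (1 / 2) ^ m) ^ 3) * 2 ^ m"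
        by simp
      also have "\<dots> = (C * \<bar>z - a\<bar> ^ 3) * ((2 ^ m * (1 / 2) ^ m) * (2 ^ m * (1 / 2) ^ m) * (1 / 2) ^ m)"
        by (simp only: power3_eq_cube mult_ac)
      also have "(2 :: real) ^ m * (1 / 2) ^ m = 1" by (simp flip: power_mult_distrib)
      finally show ?thesis by simp
    qed
    finally show ?thesis .
  qed
  have "AE \<omega> in M. summable (\<lambda>m. (S (m + N) \<omega>)\<^sup>2)"
  proof (rule AE_summable_integrable(1)[where f = "\<lambda>m \<omega>. (S (m + N) \<omega>)\<^sup>2"])
    show "integrable M (\<lambda>\<omega>. (S (m + N) \<omega>)\<^sup>2)" for m by (rule L4_integrable_power2[OF LS])
    show "expectation (\<lambda>\<omega>. (S (m + N) \<omega>)\<^sup>2) \<le> (C * \<bar>z - a\<bar> ^ 3) * (1 / 2) ^ (m + N)" for m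
      by (rule ES) simp
    show "summable (\<lambda>m. (C * \<bar>z - a\<bar> ^ 3) * (1 / 2) ^ (m + N))"
      by (intro summable_mult summable_ignore_initial_segment summable_geometric) simp
  qed simp
  \<comment> \<open>Only countably many grid points occur, so outside one null set \<open>X'\<close>
    may be replaced by \<open>Y'\<close> at all of them.\<close>
  moreover have "AE \<omega> in M. i \<le> 2 ^ m \<longrightarrow> Y' (\<tau> m i) \<omega> = X' (\<tau> m i) \<omega>" for m i
    using Y'(1)[OF \<tau>I[of i m]] by (cases "i \<le> 2 ^ m") auto
  then have "AE \<omega> in M. \<forall>m i. i \<le> 2 ^ m \<longrightarrow> Y' (\<tau> m i) \<omega> = X' (\<tau> m i) \<omega>"
    by (simp add: AE_all_countable)
  ultimately show ?thesis
  proof eventually_elim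
    case (elim \<omega>)
    let ?R = "\<lambda>n::nat. \<Sum>i<n. (z - a) / real n * Y' (a + real i / real n * (z - a)) \<omega>"
    have sub: "strict_mono (\<lambda>m. 2 ^ (m + N) :: nat)" by (intro strict_monoI power_strict_increasing) auto
    have R: "(\<lambda>m. ?R (2 ^ (m + N))) \<longlonglongrightarrow> (LBINT y=a..z. Y' y \<omega>)"
      using LIMSEQ_subseq_LIMSEQ[OF Riemann_sum_tendsto_interval_integral[OF I(2,1) az Y'(2)] sub]
      by (simp add: o_def)
    have "S m \<omega> = (X z \<omega> - X a \<omega>) - ?R (2 ^ m)" for m
    proof -
      have "S m \<omega> = (\<Sum>i<2 ^ m. X (\<tau> m (Suc i)) \<omega> - X (\<tau> m i) \<omega>) - (\<Sum>i<2 ^ m. h m * X' (\<tau> m i) \<omega>)"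
        unfolding S_def e_def \<tau>_Suc by (simp only: sum_subtractf)
      also have "(\<Sum>i<2 ^ m. X (\<tau> m (Suc i)) \<omega> - X (\<tau> m i) \<omega>) = X z \<omega> - X a \<omega>"
        unfolding sum_lessThan_telescope[of "\<lambda>i. X (\<tau> m i) \<omega>"] by (simp add: \<tau>_def)
      also have "(\<Sum>i<2 ^ m. h m * X' (\<tau> m i) \<omega>) = (\<Sum>i<2 ^ m. h m * Y' (\<tau> m i) \<omega>)"
        using elim(2) by (intro sum.cong refl) simp
      also have "\<dots> = ?R (2 ^ m)" by (simp add: h_def \<tau>_def)
      finally show ?thesis .
    qed
    moreover have "(\<lambda>m. (S (m + N) \<omega>)\<^sup>2) \<longlonglongrightarrow> 0" using elim(1) by (rule summable_LIMSEQ_zero)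
    from tendsto_real_sqrt[OF this] have "(\<lambda>m. S (m + N) \<omega>) \<longlonglongrightarrow> 0"
      by (simp add: tendsto_rabs_zero_iff)
    ultimately have "(\<lambda>m. (X z \<omega> - X a \<omega>) - ?R (2 ^ (m + N))) \<longlonglongrightarrow> 0" by simp
    from tendsto_diff[OF tendsto_const[of "X z \<omega> - X a \<omega>"] this]
    have "(\<lambda>m. ?R (2 ^ (m + N))) \<longlonglongrightarrow> X z \<omega> - X a \<omega>" by simp
    then show ?case using R by (rule LIMSEQ_unique)
  qed
qed

text \<open>Regularity of every path, without an exceptional set, is the invariant: it is preserved
  by integration and lets the pathwise integral be used for each outcome. The induction generalises
  \<open>k\<close>, \<open>V\<close> and \<open>X\<close>, since the derivative process has a
  different covariance and lives in a different space.\<close>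

theorem stationary_Ck_modification:
  assumes "stationary_process I k V X" "smooth_cov p k" and I: "is_interval I" "open I"
  obtains Y where "\<And>z. z \<in> I \<Longrightarrow> Y z \<in> borel_measurable M"
    "\<And>z. z \<in> I \<Longrightarrow> AE \<omega> in M. Y z \<omega> = X z \<omega>"
    "\<And>\<omega>. Ck_on p I (\<lambda>z. Y z \<omega>)"
proof -
  have "\<exists>Y. (\<forall>z\<in>I. Y z \<in> borel_measurable M) \<and> (\<forall>z\<in>I. AE \<omega> in M. Y z \<omega> = X z \<omega>) \<and>
    (\<forall>\<omega>. Ck_on p I (\<lambda>z. Y z \<omega>))"
    using assms(1,2)
  proof (induction p arbitrary: k V X)
    case 0
    have "lipschitz_at_zero k" using 0(2) by simp
    then obtain Y where "\<And>z. z \<in> I \<Longrightarrow> Y z \<in> borel_measurable M"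
      "\<And>z. z \<in> I \<Longrightarrow> AE \<omega> in M. Y z \<omega> = X z \<omega>" "\<And>\<omega>. continuous_on I (\<lambda>z. Y z \<omega>)"
      using stationary_continuous_modification[OF 0(1) I(2)] by blast
    then show ?case by (intro exI[of _ Y]) (simp add: Ck_on_def)
  next
    case (Suc p)
    show ?case
    proof (cases "I = {}")
      case True
      then show ?thesis by (simp add: Ck_on_def)
    next
      case False
      then obtain a where a: "a \<in> I" by blast
      from Suc.prems(2) obtain k\<^sub>1 k\<^sub>2 where
        k: "\<And>x. (k has_real_derivative k\<^sub>1 x) (at x)" "\<And>x. (k\<^sub>1 has_real_derivative k\<^sub>2 x) (at x)"
        and sm: "smooth_cov p (\<lambda>x. - k\<^sub>2 x)" by auto
      have "lipschitz_at_zero (\<lambda>x. - k\<^sub>2 x)" using smooth_cov_lipschitz_at_zero[OF sm] .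
      then have lip: "lipschitz_at_zero k\<^sub>2" by (simp add: lipschitz_at_zero_def abs_minus_commute)
      obtain V' X' C \<delta> where X': "stationary_process I (\<lambda>x. - k\<^sub>2 x) V' X'" and "\<delta> > 0"
        and bound: "\<And>t h. t \<in> I \<Longrightarrow> t + h \<in> I \<Longrightarrow> \<bar>h\<bar> < \<delta> \<Longrightarrow>
          expectation (\<lambda>\<omega>. (X (t + h) \<omega> - X t \<omega> - h * X' t \<omega>)\<^sup>2) \<le> C * \<bar>h\<bar> ^ 3"
        by (rule mean_square_derivative[OF Suc.prems(1) I(2) k lip]) (rule that)
      from Suc.IH[OF X' sm] obtain Y' where Y': "\<forall>z\<in>I. Y' z \<in> borel_measurable M"
        "\<forall>z\<in>I. AE \<omega> in M. Y' z \<omega> = X' z \<omega>" "\<forall>\<omega>. Ck_on p I (\<lambda>z. Y' z \<omega>)"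
        by (elim exE conjE) (rule that)
      note Y' = Y'[rule_format]
      have cont: "continuous_on I (\<lambda>z. Y' z \<omega>)" for \<omega>
      proof (cases p)
        case 0
        then show ?thesis using Y'(3)[of \<omega>] by (simp add: Ck_on_def)
      next
        case (Suc q)
        then have "\<forall>x\<in>I. (deriv ^^ 0) (\<lambda>z. Y' z \<omega>) field_differentiable (at x)"
          using Y'(3)[of \<omega>, unfolded Ck_on_def] by blast
        then show ?thesis
          by (auto intro: continuous_at_imp_continuous_on field_differentiable_imp_continuous_at)
      qed
      \<comment> \<open>One base point \<open>a\<close> and one random constant \<open>X a\<close>
        serve all \<open>z\<close>; choosing them requires \<open>I\<close> to be nonempty, hence
        the case split.\<close>
      define Y where "Y z \<omega> = X a \<omega> + (LBINT y=a..z. Y' y \<omega>)" for z :: real and \<omega>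
      have L: "L4 (X z)" "L4 (X' z)" if "z \<in> I" for z
        using Suc.prems(1) X' that kurtosis_spaceD(1) by (auto simp: stationary_process_def)
      show ?thesis
      proof (intro exI[of _ Y] conjI ballI allI)
        fix z assume z: "z \<in> I"
        \<comment> \<open>Measurability in the outcome is inherited from the Riemann sums, which
          involve finitely many random variables each.\<close>
        let ?R = "\<lambda>n \<omega>. \<Sum>i<n. (z - a) / real n * Y' (a + real i / real n * (z - a)) \<omega>"
        have "(\<lambda>\<omega>. LBINT y=a..z. Y' y \<omega>) \<in> borel_measurable M"
        proof (rule borel_measurable_LIMSEQ_real)
          show "(\<lambda>n. ?R n \<omega>) \<longlonglongrightarrow> (LBINT y=a..z. Y' y \<omega>)" for \<omega>
            by (rule Riemann_sum_tendsto_interval_integral[OF I(2,1) a z cont])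
          fix n :: nat
          have "a + real i / real n * (z - a) \<in> I" if "i < n" for i
            using that by (intro is_interval_affine_mem[OF I(1) a z]) auto
          then show "?R n \<in> borel_measurable M"
            by (intro borel_measurable_sum borel_measurable_times borel_measurable_const Y') simp
        qed
        then show "Y z \<in> borel_measurable M"
          unfolding Y_def using L(1)[OF a] by (intro borel_measurable_add) (auto simp: L4_def)
        have "AE \<omega> in M. X z \<omega> - X a \<omega> = (LBINT y=a..z. Y' y \<omega>)"
          by (rule mean_square_antiderivative[OF I a z L bound \<open>\<delta> > 0\<close> Y'(2) cont])
        then show "AE \<omega> in M. Y z \<omega> = X z \<omega>"
          by eventually_elim (simp add: Y_def flip: diff_eq_eq)
      next
        fix \<omega>
        show "Ck_on (Suc p) I (\<lambda>z. Y z \<omega>)"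
        proof (rule Ck_on_Suc[OF I(2) _ Y'(3)])
          fix x assume "x \<in> I"
          from interval_lebesgue_integral_has_derivative[OF I(2,1) a this cont]
          show "((\<lambda>z. Y z \<omega>) has_real_derivative Y' x \<omega>) (at x)"
            unfolding Y_def using DERIV_add[OF DERIV_const] by fastforce
        qed
      qed
    qed
  qed
  then show thesis using that by blast
qed

section \<open>Gaussian processes\<close>

lemma bounded_kurtosis_AE_zero:
  assumes [measurable]: "f \<in> borel_measurable M" and "AE \<omega> in M. f \<omega> = 0"
  shows "bounded_kurtosis f"
proof -
  have "L4 f" by (rule L4_dominated[of "\<lambda>_. 0"]) (use assms in \<open>auto simp: L4_def\<close>)
  moreover have "expectation (\<lambda>\<omega>. f \<omega> ^ 4) = expectation (\<lambda>_. 0)"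
    by (rule integral_cong_AE) (use assms in auto)
  ultimately show ?thesis by (simp add: bounded_kurtosis_def)
qed

text \<open>A point mass becomes almost surely \<open>0\<close> after centring. For a normal law
  with standard deviation \<open>s\<close> the even moments of orders \<open>2\<close> and
  \<open>4\<close> are \<open>s^2\<close> and \<open>3 * s^4\<close>.\<close>

lemma gaussian_rv_bounded_kurtosis:
  assumes "gaussian_rv M S"
  shows "integrable M S" "bounded_kurtosis (\<lambda>\<omega>. S \<omega> - expectation S)"
proof -
  have [measurable]: "S \<in> borel_measurable M" using assms by (simp add: gaussian_rv_def)
  from assms consider m where "distr M borel S = return borel m"
    | m s where "s > 0" "distributed M lborel S (normal_density m s)"
    by (auto simp: gaussian_rv_def)
  then have "integrable M S \<and> bounded_kurtosis (\<lambda>\<omega>. S \<omega> - expectation S)"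
  proof cases
    case 1
    have "AE x in distr M borel S. x = m" unfolding 1 by (simp add: AE_return)
    then have ae: "AE \<omega> in M. S \<omega> = m" by (simp add: AE_distr_iff)
    have "integrable M S \<longleftrightarrow> integrable M (\<lambda>_. m)" by (rule integrable_cong_AE) (use ae in auto)
    moreover have "expectation S = expectation (\<lambda>_. m)" by (rule integral_cong_AE) (use ae in auto)
    ultimately show ?thesis
      using ae by (auto simp: prob_space intro!: bounded_kurtosis_AE_zero)
  next
    case 2
    have moment: "integrable M (\<lambda>\<omega>. (S \<omega> - m) ^ (2 * k))"
      "expectation (\<lambda>\<omega>. (S \<omega> - m) ^ (2 * k)) = fact (2 * k) / ((2 / s\<^sup>2) ^ k * fact k)" for k
    proof -
      note hb = normal_moment_even[OF \<open>s > 0\<close>, of m k]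
      show "integrable M (\<lambda>\<omega>. (S \<omega> - m) ^ (2 * k))"
        using has_bochner_integral_integrable
          distributed_integrable[OF 2(2), of "\<lambda>x. (x - m) ^ (2 * k)"] hb
        by (auto simp: has_bochner_integral_iff)
      show "expectation (\<lambda>\<omega>. (S \<omega> - m) ^ (2 * k)) = fact (2 * k) / ((2 / s\<^sup>2) ^ k * fact k)"
        using distributed_integral[OF 2(2), of "\<lambda>x. (x - m) ^ (2 * k)"] hb
        by (auto simp: has_bochner_integral_iff)
    qed
    have int: "integrable M (\<lambda>\<omega>. (S \<omega> - m) ^ 4)" using moment(1)[of 2] by simp
    then have L: "L4 (\<lambda>\<omega>. S \<omega> - m)" by (simp add: L4_def)
    have "integrable M (\<lambda>\<omega>. (S \<omega> - m) * 1)" by (rule L4_integrable_mult[OF L]) (simp add: L4_def)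
    then have "integrable M (\<lambda>\<omega>. S \<omega> - m)" by simp
    from Bochner_Integration.integrable_add[OF this integrable_const[of m]]
    have "integrable M S" by simp
    moreover have "expectation S = m" by (rule normal_distributed_expectation[OF \<open>s > 0\<close> 2(2)])
    moreover have "expectation (\<lambda>\<omega>. (S \<omega> - m)\<^sup>2) = s\<^sup>2" using moment(2)[of 1] by simp
    moreover have "expectation (\<lambda>\<omega>. (S \<omega> - m) ^ 4) = 3 * (s\<^sup>2)\<^sup>2"
    proof -
      have "fact (2 * 2) / ((2 / s\<^sup>2)\<^sup>2 * fact 2) = 3 * (s\<^sup>2)\<^sup>2"
        by (simp add: fact_numeral power_divide)
      then show ?thesis using moment(2)[of 2] by simp
    qed
    ultimately show ?thesis using L by (simp add: bounded_kurtosis_def)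
  qed
  then show "integrable M S" "bounded_kurtosis (\<lambda>\<omega>. S \<omega> - expectation S)" by auto
qed

text \<open>Joint Gaussianity enters here: every finite combination of the \<open>X j\<close> is
  Gaussian, and subtracting the same combination of means centres it.\<close>

lemma gaussian_process_kurtosis_space:
  assumes "gaussian_process M I \<mu> K X"
  shows "kurtosis_space {\<lambda>\<omega>. \<Sum>j\<in>J. b j * (X j \<omega> - \<mu> j) | J b. finite J \<and> J \<subseteq> I}"
    (is "kurtosis_space ?V")
  unfolding kurtosis_space_def
proof (intro conjI ballI allI)
  have g: "gaussian_rv M (\<lambda>\<omega>. \<Sum>j\<in>J. b j * X j \<omega>)" if "finite J" "J \<subseteq> I" for J b
    using assms that by (auto simp: gaussian_process_def gaussian_vector_def)
  have int: "integrable M (X j)" if "j \<in> I" for j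
    using gaussian_rv_bounded_kurtosis(1)[OF g[of "{j}" "\<lambda>_. 1"]] that by simp
  show "bounded_kurtosis f" if "f \<in> ?V" for f
  proof -
    from \<open>f \<in> ?V\<close> obtain J b where f: "f = (\<lambda>\<omega>. \<Sum>j\<in>J. b j * (X j \<omega> - \<mu> j))"
      and J: "finite J" "J \<subseteq> I"
      unfolding mem_Collect_eq by (elim exE conjE) (rule that)
    have "expectation (\<lambda>\<omega>. \<Sum>j\<in>J. b j * X j \<omega>) = (\<Sum>j\<in>J. b j * \<mu> j)"
      using assms J int by (subst Bochner_Integration.integral_sum) (auto simp: gaussian_process_def intro!: sum.cong)
    then show ?thesis
      using gaussian_rv_bounded_kurtosis(2)[OF g[OF J, of b]] unfolding f
      by (simp add: right_diff_distrib sum_subtractf)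
  qed
  fix f f' and a b :: real
  assume "f \<in> ?V"
  then obtain J c where f: "f = (\<lambda>\<omega>. \<Sum>j\<in>J. c j * (X j \<omega> - \<mu> j))" and J: "finite J" "J \<subseteq> I"
    unfolding mem_Collect_eq by (elim exE conjE) (rule that)
  assume "f' \<in> ?V"
  then obtain J' c' where f': "f' = (\<lambda>\<omega>. \<Sum>j\<in>J'. c' j * (X j \<omega> - \<mu> j))" and J': "finite J'" "J' \<subseteq> I"
    unfolding mem_Collect_eq by (elim exE conjE) (rule that)
  \<comment> \<open>Both coefficient families are extended by \<open>0\<close> to the union of the
    index sets, so shared indices simply add up.\<close>
  define d where "d j = a * (if j \<in> J then c j else 0) + b * (if j \<in> J' then c' j else 0)" for j
  have "f \<omega> = (\<Sum>j\<in>J \<union> J'. (if j \<in> J then c j else 0) * (X j \<omega> - \<mu> j))" for \<omega>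
    unfolding f using J J' by (intro sum.mono_neutral_cong_left) auto
  moreover have "f' \<omega> = (\<Sum>j\<in>J \<union> J'. (if j \<in> J' then c' j else 0) * (X j \<omega> - \<mu> j))" for \<omega>
    unfolding f' using J J' by (intro sum.mono_neutral_cong_left) auto
  ultimately have "(\<lambda>\<omega>. a * f \<omega> + b * f' \<omega>) = (\<lambda>\<omega>. \<Sum>j\<in>J \<union> J'. d j * (X j \<omega> - \<mu> j))"
    by (simp only: d_def sum_distrib_left distrib_right sum.distrib mult.assoc)
  then show "(\<lambda>\<omega>. a * f \<omega> + b * f' \<omega>) \<in> ?V"
    unfolding mem_Collect_eq using J J' by (intro exI[of _ "J \<union> J'"] exI[of _ d]) auto
qed

end

theorem corollary2:
  fixes M :: "'a measure" and I :: "real set" and X :: "real \<Rightarrow> 'a \<Rightarrow> real"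
    and \<mu> :: "real \<Rightarrow> real" and p :: nat and \<sigma> \<rho> :: real
  assumes "prob_space M"
    and "\<sigma> > 0" and "\<rho> > 0"
    and "open I" and "is_interval I"
    and "gaussian_process M I \<mu> (matern_cov p \<sigma> \<rho>) X"
    and "Ck_on p I \<mu>"
  shows "\<exists>Y. is_modification M I X Y \<and>
             measure M {\<omega> \<in> space M. Ck_on p I (\<lambda>z. Y z \<omega>)} = 1"
proof -
  interpret prob_space M by fact
  let ?V = "{\<lambda>\<omega>. \<Sum>j\<in>J. b j * (X j \<omega> - \<mu> j) | J b. finite J \<and> J \<subseteq> I}"
  have XV: "(\<lambda>\<omega>. X z \<omega> - \<mu> z) \<in> ?V" if "z \<in> I" for z
    using that by (auto intro!: exI[of _ "{z}"] exI[of _ "\<lambda>_. 1"])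
  \<comment> \<open>\<open>matern_cov\<close> depends on its last two arguments through their
    distance, so its section at \<open>0\<close>, evaluated at \<open>s - t\<close>, recovers
    it.\<close>
  have "stationary_process I (\<lambda>r. matern_cov p \<sigma> \<rho> r 0) ?V (\<lambda>z \<omega>. X z \<omega> - \<mu> z)"
    unfolding stationary_process_def
    using gaussian_process_kurtosis_space[OF assms(6)] XV assms(6)
    by (auto simp: gaussian_process_def matern_cov_def)
  then obtain Y where Y: "\<And>z. z \<in> I \<Longrightarrow> Y z \<in> borel_measurable M"
      "\<And>z. z \<in> I \<Longrightarrow> AE \<omega> in M. Y z \<omega> = X z \<omega> - \<mu> z" "\<And>\<omega>. Ck_on p I (\<lambda>z. Y z \<omega>)"
    using stationary_Ck_modification[OF _ smooth_cov_matern_cov[OF assms(3)] assms(5,4)] by blast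
  define Z where "Z z \<omega> = Y z \<omega> + \<mu> z" for z \<omega>
  have "is_modification M I X Z"
    unfolding is_modification_def
  proof (intro ballI conjI)
    fix z assume z: "z \<in> I"
    have "gaussian_vector M {z} X" using assms(6) z by (auto simp: gaussian_process_def)
    then have X[measurable]: "X z \<in> borel_measurable M" by (simp add: gaussian_vector_def)
    show Z[measurable]: "Z z \<in> borel_measurable M" unfolding Z_def using Y(1)[OF z] by simp
    have "AE \<omega> in M. X z \<omega> = Z z \<omega>" using Y(2)[OF z] by eventually_elim (simp add: Z_def)
    then show "measure M {\<omega> \<in> space M. X z \<omega> = Z z \<omega>} = 1" by (subst prob_Collect_eq_1) auto
  qed
  moreover have "Ck_on p I (\<lambda>z. Z z \<omega>)" for \<omega>
    unfolding Z_def by (rule Ck_on_add[OF assms(4) Y(3) assms(7)])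
  \<comment> \<open>Every path is regular, so the event is all of \<open>space M\<close> and its
    measurability is immediate.\<close>
  then have "measure M {\<omega> \<in> space M. Ck_on p I (\<lambda>z. Z z \<omega>)} = 1" by (simp add: prob_space)
  ultimately show ?thesis by blast
qed

end
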